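(* The Landau Hamiltonian $$\widetilde{H}_{L}=-(\partial_{x}^{2}+\partial_{y}^{2})+i(x\partial_{y}-y\partial_{x})+\tfrac{1}{4}(x^{2}+y^{2}),$$ acting on functions of $(x,y)\in\mathbb{R}^2$, satisfies $\widetilde{H}_{L}\in\widetilde{HG}_{1}^{2,2}(\mathbb{R}^{4})$.
   Context: Every linear continuous $A:\mathcal{S}(\mathbb{R}^{m})\to\mathcal{S}'(\mathbb{R}^{m})$ has a unique Weyl symbol $a\in\mathcal{S}'(\mathbb{R}^{2m})$, written $A=\operatorname{Op}^w(a)$, with $A\psi(x)=(2\pi)^{-m}\int_{\mathbb{R}^{2m}}e^{i(x-y)\cdot\xi}a(\tfrac12(x+y),\xi)\psi(y)\,dy\,d\xi$ (in the sense of distributions). $\operatorname{Sp}(2m,\mathbb{R})$ is the group of linear automorphisms of $\mathbb{R}^{m}_x\times\mathbb{R}^m_\xi$ preserving $\sigma_m((x,\xi),(x',\xi'))=\xi\cdot x'-\xi'\cdot x$. Symplectic dimensional extension of symbols (from $\mathbb{R}^{2(n-k)}$ to $\mathbb{R}^{2n}$): write points of $\mathbb{R}^{2n}$ as $(x,y;\xi,\eta)$ with $x,\xi\in\mathbb{R}^{n-k}$, $y,\eta\in\mathbb{R}^k$. For $a\in\mathcal{S}'(\mathbb{R}^{2(n-k)})$ and $s\in\operatorname{Sp}(2n,\mathbb{R})$ put $(a\otimes1_{2k})(x,y;\xi,\eta)=a(x,\xi)$ and $E_s[a]=(a\otimes 1_{2k})\circ s$. Shubin class: for real $m_0\le m_1$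 and $0<\rho\le1$, $H\Gamma_\rho^{m_1,m_0}(\mathbb{R}^{2m})$ is the set of $a\in C^\infty(\mathbb{R}^{2m})$ such that for $|z|$ sufficiently large $C_0|z|^{m_0}\le|a(z)|\le C_1|z|^{m_1}$ for some $C_0,C_1>0$ and, for every $\alpha\in\mathbb{N}^{2m}$, there is $C_\alpha\ge0$ with $|\partial_z^\alpha a(z)|\le C_\alpha|a(z)||z|^{-\rho|\alpha|}$. Extended Shubin class: $\widetilde{HG}_\rho^{m_1,m_0}(\mathbb{R}^{2n})$ is the set of operators with Weyl symbol $E_s[a]\in C^\infty(\mathbb{R}^{2n})$ for some $k\in\{0,\dots,n-1\}$, $a\in H\Gamma_\rho^{m_1,m_0}(\mathbb{R}^{2(n-k)})$ and $s\in\operatorname{Sp}(2n,\mathbb{R})$. *)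

theory Defs
  imports "HOL-Analysis.Analysis"
begin

text \<open>
  \<open>\<real>\<^sup>n\<close> is a type \<open>'v :: euclidean_space\<close> with \<open>n = DIM('v)\<close>, and phase space is \<open>'v \<times> 'v\<close>, with
  points \<open>(x, \<xi>)\<close>. A lower-dimensional Euclidean space is realised as the coordinate subspace
  \<open>span B\<close> for a set \<open>B \<subseteq> Basis\<close>; notions for functions on it only look at points of \<open>span B\<close>
  and at directions in \<open>B\<close>. The full space is the case \<open>B = Basis\<close>.
\<close>

section \<open>Smooth functions, Schwartz space and tempered distributions\<close>

definition dir_deriv :: "'a::real_normed_vector \<Rightarrow> ('a \<Rightarrow> complex) \<Rightarrow> 'a \<Rightarrow> complex" where
  "dir_deriv v f x = vector_derivative (\<lambda>t. f (x + t *\<^sub>R v)) (at 0)"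

text \<open>
  A multi-index \<open>\<alpha>\<close> is given by a list of coordinate directions, so \<open>\<bar>\<alpha>\<bar>\<close> is its length. For smooth
  functions the order of the list is irrelevant.
\<close>

primrec partials :: "'a::real_normed_vector list \<Rightarrow> ('a \<Rightarrow> complex) \<Rightarrow> 'a \<Rightarrow> complex" where
  "partials [] f = f"
| "partials (d # ds) f = dir_deriv d (partials ds f)"

definition smooth_along :: "'a::euclidean_space set \<Rightarrow> ('a \<Rightarrow> complex) \<Rightarrow> bool" where
  "smooth_along B f \<longleftrightarrow> (\<forall>ds. set ds \<subseteq> B \<longrightarrow>
     continuous_on (span B) (partials ds f) \<and>
     (\<forall>b\<in>B. \<forall>x\<in>span B. (\<lambda>t. partials ds f (x + t *\<^sub>R b)) differentiable (at 0)))"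

abbreviation smooth :: "('a::euclidean_space \<Rightarrow> complex) \<Rightarrow> bool" where
  "smooth \<equiv> smooth_along Basis"

definition schwartz :: "('a::euclidean_space \<Rightarrow> complex) set" where
  "schwartz = {f. smooth f \<and>
     (\<forall>N ds. set ds \<subseteq> Basis \<longrightarrow>
        bdd_above (range (\<lambda>x. (1 + norm x) ^ N * norm (partials ds f x))))}"

definition schwartz_norm :: "nat \<Rightarrow> ('a::euclidean_space \<Rightarrow> complex) \<Rightarrow> real" where
  "schwartz_norm N f = (\<Sum>ds\<in>{ds. set ds \<subseteq> Basis \<and> length ds \<le> N}.
     SUP x. (1 + norm x) ^ N * norm (partials ds f x))"

text \<open>
  Functionals are total on all functions; only their values on \<^const>\<open>schwartz\<close> are meaningful.
\<close>

definition tempered :: "(('a::euclidean_space \<Rightarrow> complex) \<Rightarrow> complex) \<Rightarrow> bool" where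
  "tempered u \<longleftrightarrow>
     (\<forall>f\<in>schwartz. \<forall>g\<in>schwartz. u (\<lambda>x. f x + g x) = u f + u g) \<and>
     (\<forall>c. \<forall>f\<in>schwartz. u (\<lambda>x. c * f x) = c * u f) \<and>
     (\<exists>C N. \<forall>f\<in>schwartz. norm (u f) \<le> C * schwartz_norm N f)"

definition distr_of :: "('a::euclidean_space \<Rightarrow> complex) \<Rightarrow> ('a \<Rightarrow> complex) \<Rightarrow> complex" where
  "distr_of f = (\<lambda>\<phi>. \<integral>x. f x * \<phi> x \<partial>lborel)"


section \<open>Operators and Weyl symbols\<close>

text \<open>
  \<open>A \<psi> \<phi>\<close> is the bilinear pairing of the distribution \<open>A \<psi>\<close> with the test function \<open>\<phi>\<close>.
\<close>

type_synonym 'v oper = "('v \<Rightarrow> complex) \<Rightarrow> ('v \<Rightarrow> complex) \<Rightarrow> complex"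

text \<open>
  Linear continuous maps from the Schwartz space to tempered distributions, the latter carrying
  the weak-* topology: linearity and continuity in \<open>\<psi>\<close> are the second conjunct.
\<close>

definition continuous_oper :: "'v::euclidean_space oper \<Rightarrow> bool" where
  "continuous_oper A \<longleftrightarrow>
     (\<forall>\<psi>\<in>schwartz. tempered (A \<psi>)) \<and> (\<forall>\<phi>\<in>schwartz. tempered (\<lambda>\<psi>. A \<psi> \<phi>))"

definition oper_of :: "(('v::euclidean_space \<Rightarrow> complex) \<Rightarrow> ('v \<Rightarrow> complex)) \<Rightarrow> 'v oper" where
  "oper_of H = (\<lambda>\<psi>. distr_of (H \<psi>))"

text \<open>
  Pairing \<open>(2\<pi>)\<^sup>-\<^sup>n \<integral>\<integral> e\<^bsup>i(x - y)\<cdot>\<xi>\<^esup> a((x + y)/2, \<xi>) \<psi>(y) dy d\<xi>\<close> with \<open>\<phi>(x)\<close> and substituting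
  \<open>x = q + p/2\<close>, \<open>y = q - p/2\<close> (Jacobian 1) gives \<open>(2\<pi>)\<^sup>-\<^sup>n\<close> times the pairing of \<open>a\<close> with the
  Schwartz function \<open>wigner \<psi> \<phi>\<close> of \<open>(q, \<xi>)\<close>, which makes sense for every tempered \<open>a\<close>.
\<close>

definition wigner ::
  "('v::euclidean_space \<Rightarrow> complex) \<Rightarrow> ('v \<Rightarrow> complex) \<Rightarrow> 'v \<times> 'v \<Rightarrow> complex" where
  "wigner \<psi> \<phi> = (\<lambda>(q, \<xi>).
     \<integral>p. exp (\<i> * complex_of_real (p \<bullet> \<xi>)) * \<psi> (q - p /\<^sub>R 2) * \<phi> (q + p /\<^sub>R 2) \<partial>lborel)"

definition weyl_op :: "(('v::euclidean_space \<times> 'v \<Rightarrow> complex) \<Rightarrow> complex) \<Rightarrow> 'v oper" where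
  "weyl_op u = (\<lambda>\<psi> \<phi>. u (wigner \<psi> \<phi>) / complex_of_real ((2 * pi) ^ DIM('v)))"

definition has_weyl_symbol ::
  "'v::euclidean_space oper \<Rightarrow> (('v \<times> 'v \<Rightarrow> complex) \<Rightarrow> complex) \<Rightarrow> bool" where
  "has_weyl_symbol A u \<longleftrightarrow> continuous_oper A \<and> tempered u \<and>
     (\<forall>\<psi>\<in>schwartz. \<forall>\<phi>\<in>schwartz. A \<psi> \<phi> = weyl_op u \<psi> \<phi>)"


section \<open>Symplectic dimensional extension\<close>

definition sympl_form :: "'v::euclidean_space \<times> 'v \<Rightarrow> 'v \<times> 'v \<Rightarrow> real" where
  "sympl_form = (\<lambda>(x, \<xi>) (x', \<xi>'). \<xi> \<bullet> x' - \<xi>' \<bullet> x)"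

definition Sp :: "('v::euclidean_space \<times> 'v \<Rightarrow> 'v \<times> 'v) set" where
  "Sp = {s. linear s \<and> bij s \<and> (\<forall>z z'. sympl_form (s z) (s z') = sympl_form z z')}"

text \<open>
  For \<open>J \<subseteq> Basis\<close> with \<open>card J = n - k\<close>, \<open>span J\<close> is the space \<open>\<real>\<^sup>n\<^sup>-\<^sup>k\<close> of the first variables and
  \<open>span (phase_basis J)\<close> is its phase space, of dimension \<open>2(n - k)\<close>.
\<close>

definition phase_basis :: "'v::euclidean_space set \<Rightarrow> ('v \<times> 'v) set" where
  "phase_basis J = (\<lambda>b. (b, 0)) ` J \<union> (\<lambda>b. (0, b)) ` J"

definition coord_proj :: "'v::euclidean_space set \<Rightarrow> 'v \<Rightarrow> 'v" where
  "coord_proj J x = (\<Sum>b\<in>J. (x \<bullet> b) *\<^sub>R b)"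

definition tensor_one ::
  "'v::euclidean_space set \<Rightarrow> ('v \<times> 'v \<Rightarrow> complex) \<Rightarrow> 'v \<times> 'v \<Rightarrow> complex" where
  "tensor_one J a = (\<lambda>(x, \<xi>). a (coord_proj J x, coord_proj J \<xi>))"

definition sympl_ext ::
  "'v::euclidean_space set \<Rightarrow> ('v \<times> 'v \<Rightarrow> 'v \<times> 'v) \<Rightarrow> ('v \<times> 'v \<Rightarrow> complex) \<Rightarrow>
     'v \<times> 'v \<Rightarrow> complex" where
  "sympl_ext J s a = tensor_one J a \<circ> s"


section \<open>Shubin classes\<close>

text \<open>
  The class of symbols on \<open>span B\<close>. The derivative bounds, like the two-sided bound, are required
  for large \<open>\<bar>z\<bar>\<close>. As \<open>a\<close> has no zeros there, a threshold depending on the multi-index would give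
  the same class.
\<close>

definition shubin_class ::
  "'a::euclidean_space set \<Rightarrow> real \<Rightarrow> real \<Rightarrow> real \<Rightarrow> ('a \<Rightarrow> complex) set" where
  "shubin_class B m1 m0 \<rho> = {a. m0 \<le> m1 \<and> 0 < \<rho> \<and> \<rho> \<le> 1 \<and> smooth_along B a \<and>
     (\<exists>R>0.
        (\<exists>C0>0. \<exists>C1>0. \<forall>z\<in>span B. R \<le> norm z \<longrightarrow>
           C0 * norm z powr m0 \<le> norm (a z) \<and> norm (a z) \<le> C1 * norm z powr m1) \<and>
        (\<forall>ds. set ds \<subseteq> B \<longrightarrow> (\<exists>C\<ge>0. \<forall>z\<in>span B. R \<le> norm z \<longrightarrow>
           norm (partials ds a z) \<le> C * norm (a z) * norm z powr (- \<rho> * real (length ds)))))}"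

text \<open>
  All choices of \<open>n - k\<close> coordinates \<open>J\<close> are allowed; permuting the coordinates of \<open>x\<close> and \<open>\<xi>\<close>
  simultaneously is symplectic, so fixing one choice for each \<open>k\<close> would give the same class.
\<close>

definition ext_shubin_class :: "real \<Rightarrow> real \<Rightarrow> real \<Rightarrow> 'v::euclidean_space oper set" where
  "ext_shubin_class m1 m0 \<rho> = {A. \<exists>k<DIM('v). \<exists>J\<subseteq>Basis. card J = DIM('v) - k \<and>
     (\<exists>a\<in>shubin_class (phase_basis J) m1 m0 \<rho>. \<exists>s\<in>Sp.
        smooth (sympl_ext J s a) \<and> has_weyl_symbol A (distr_of (sympl_ext J s a)))}"


section \<open>The Landau Hamiltonian\<close>

abbreviation pdx :: "(real \<times> real \<Rightarrow> complex) \<Rightarrow> real \<times> real \<Rightarrow> complex" where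
  "pdx \<equiv> dir_deriv (1, 0)"

abbreviation pdy :: "(real \<times> real \<Rightarrow> complex) \<Rightarrow> real \<times> real \<Rightarrow> complex" where
  "pdy \<equiv> dir_deriv (0, 1)"

definition landau_hamiltonian :: "(real \<times> real \<Rightarrow> complex) \<Rightarrow> real \<times> real \<Rightarrow> complex" where
  "landau_hamiltonian \<psi> = (\<lambda>(x, y).
     - (pdx (pdx \<psi>) (x, y) + pdy (pdy \<psi>) (x, y))
     + \<i> * (complex_of_real x * pdy \<psi> (x, y) - complex_of_real y * pdx \<psi> (x, y))
     + complex_of_real ((x\<^sup>2 + y\<^sup>2) / 4) * \<psi> (x, y))"

end

theory Submission
  imports Defs "HOL-Probability.Characteristic_Functions" "HOL-Probability.Sinc_Integral"
begin

text \<open>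
  The Landau Hamiltonian is the sum of the squares of the first order operators \<open>-\<i>\<partial>\<^sub>x + y/2\<close> and
  \<open>-\<i>\<partial>\<^sub>y - x/2\<close>, which are the quantisations of the linear forms \<open>\<xi> + y/2\<close> and
  \<open>\<eta> - x/2\<close>. Its Weyl symbol is \<open>(\<xi> + y/2)\<^sup>2 + (\<eta> - x/2)\<^sup>2\<close>. The two forms have Poisson bracket 1 up to
  sign, hence are conjugate coordinates \<open>X\<close>, \<open>\<Xi>\<close> of a linear symplectic coordinate system. In these coordinates
  the symbol is that of the harmonic oscillator, \<open>X\<^sup>2 + \<Xi>\<^sup>2\<close>, and does not depend on the remaining pair
  of variables: it is the symplectic dimensional extension of \<open>\<bar>z\<bar>\<^sup>2\<close>, which belongs to the Shubin
  class on \<open>\<real>\<^sup>2\<close> (\<open>two_squares_in_shubin_class\<close>).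

  The analytic part is that the square of a quantised linear form has the square of the form as
  its Weyl symbol. Let \<open>P\<close> be the quantisation of \<open>z \<mapsto> c \<bullet> z\<close> and \<open>P\<^sup>t\<close> its transpose. Integration by
  parts in the integral defining the Wigner function \<open>W(\<psi>, \<phi>)\<close> gives
  \<open>2 (c \<bullet> z) W(\<psi>, \<phi>) = W(P\<psi>, \<phi>) + W(\<psi>, P\<^sup>t\<phi>)\<close> (\<open>wigner_mult_linear\<close>). Since Wigner functions of Schwartz
  functions are bounded, iterating this identity shows that they decay fast enough to be integrable,
  even after multiplication by polynomials, which justifies all manipulations below. Fourier inversion on each fibre
  gives \<open>\<integral> W(\<psi>, \<phi>) = (2\<pi>)\<^sup>n \<integral> \<psi> \<phi>\<close> (\<open>integral_wigner\<close>). Applying the identity twice and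
  integrating, every term becomes \<open>(2\<pi>)\<^sup>n \<integral> (P\<^sup>2\<psi>) \<phi>\<close>, which is the assertion (\<open>integral_square_wigner\<close>).
\<close>

section \<open>Integration over Euclidean space\<close>

lemma
  fixes f :: "'v::euclidean_space \<Rightarrow> real \<Rightarrow> 'b::{real_normed_field,banach,second_countable_topology}"
  assumes int: "\<And>b. b \<in> Basis \<Longrightarrow> integrable lborel (f b)"
  shows integrable_lborel_prod: "integrable lborel (\<lambda>x. \<Prod>b\<in>Basis. f b (x \<bullet> b))"
    and integral_lborel_prod:
      "(\<integral>x. (\<Prod>b\<in>Basis. f b (x \<bullet> b)) \<partial>lborel) = (\<Prod>b\<in>Basis. \<integral>t. f b t \<partial>lborel)"
proof -
  interpret product_sigma_finite "\<lambda>_::'v. lborel :: real measure" ..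
  let ?P = "\<Pi>\<^sub>M b\<in>(Basis::'v set). (lborel :: real measure)"
  let ?T = "\<lambda>u. \<Sum>b\<in>(Basis::'v set). u b *\<^sub>R b"
  let ?g = "\<lambda>x. \<Prod>b\<in>Basis. f b (x \<bullet> b)"
  have T: "?T \<in> ?P \<rightarrow>\<^sub>M borel" by simp
  have [measurable]: "f b \<in> borel_measurable borel" if "b \<in> Basis" for b
    using borel_measurable_integrable[OF int[OF that]] by simp
  have g: "?g \<in> borel_measurable borel" by measurable
  have gT: "?g (?T u) = (\<Prod>b\<in>Basis. f b (u b))" for u by simp
  have "integrable (distr ?P borel ?T) ?g"
    by (subst integrable_distr_eq[OF T g], subst gT) (rule product_integrable_prod, auto intro: int)
  then show "integrable lborel ?g" by (simp add: lborel_eq[symmetric])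
  have "integral\<^sup>L (distr ?P borel ?T) ?g = (\<integral>u. (\<Prod>b\<in>Basis. f b (u b)) \<partial>?P)"
    by (subst integral_distr[OF T g], subst gT) (rule refl)
  also have "\<dots> = (\<Prod>b\<in>Basis. \<integral>t. f b t \<partial>lborel)"
    by (rule product_integral_prod) (auto intro: int)
  finally show "integral\<^sup>L lborel ?g = (\<Prod>b\<in>Basis. \<integral>t. f b t \<partial>lborel)"
    by (simp add: lborel_eq[symmetric])
qed

lemma integrable_lborel_prod_inverse_square:
  "integrable lborel (\<lambda>x::'v::euclidean_space. \<Prod>b\<in>Basis. inverse (1 + (x \<bullet> b)\<^sup>2))"
  using integrable_inverse_1_plus_square
  by (intro integrable_lborel_prod) (simp add: set_integrable_def)

text \<open>
  Each factor \<open>1 + x\<^sub>b\<^sup>2\<close> is at most \<open>(1 + \<bar>x\<bar>)\<^sup>2\<close>. This makes the exponent \<open>2 * DIM('v)\<close> a sufficient rate of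
  decay for integrability, and it is the rate used below.
\<close>

lemma prod_inverse_square_bound:
  fixes x :: "'v::euclidean_space"
  shows "inverse ((1 + norm x) ^ (2 * DIM('v))) \<le> (\<Prod>b\<in>Basis. inverse (1 + (x \<bullet> b)\<^sup>2))"
proof -
  have "1 + (x \<bullet> b)\<^sup>2 \<le> (1 + norm x)\<^sup>2" if "b \<in> Basis" for b
  proof -
    have "(x \<bullet> b)\<^sup>2 \<le> (norm x)\<^sup>2"
      using Basis_le_norm[OF that, of x] by (metis abs_ge_zero power2_abs power_mono)
    moreover have "(1 + norm x)\<^sup>2 = 1 + 2 * norm x + (norm x)\<^sup>2" by (simp add: power2_sum)
    ultimately show ?thesis using norm_ge_zero[of x] by linarith
  qed
  then have "(\<Prod>b\<in>(Basis::'v set). 1 + (x \<bullet> b)\<^sup>2) \<le> (\<Prod>b\<in>(Basis::'v set). (1 + norm x)\<^sup>2)"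
    by (intro prod_mono) auto
  also have "\<dots> = (1 + norm x) ^ (2 * DIM('v))" by (simp add: power_mult)
  finally have *: "(\<Prod>b\<in>(Basis::'v set). 1 + (x \<bullet> b)\<^sup>2) \<le> (1 + norm x) ^ (2 * DIM('v))" .
  have "0 < (\<Prod>b\<in>(Basis::'v set). 1 + (x \<bullet> b)\<^sup>2)" by (intro prod_pos) (auto simp: add_pos_nonneg)
  with * have "inverse ((1 + norm x) ^ (2 * DIM('v))) \<le> inverse (\<Prod>b\<in>(Basis::'v set). 1 + (x \<bullet> b)\<^sup>2)"
    by (rule le_imp_inverse_le)
  also have "\<dots> = (\<Prod>b\<in>Basis. inverse (1 + (x \<bullet> b)\<^sup>2))"
    using prod_inversef[of "\<lambda>b. 1 + (x \<bullet> b)\<^sup>2" "Basis::'v set"] by (simp add: o_def)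
  finally show ?thesis .
qed

lemma integrable_inverse_power_norm:
  "integrable lborel (\<lambda>x::'v::euclidean_space. inverse ((1 + norm x) ^ (2 * DIM('v))))"
  by (rule Bochner_Integration.integrable_bound[OF integrable_lborel_prod_inverse_square])
     (auto simp: abs_of_nonneg prod_nonneg prod_inverse_square_bound)

lemma integrable_if_decay:
  fixes f :: "'v::euclidean_space \<Rightarrow> complex"
  assumes "f \<in> borel_measurable borel"
    and "\<And>x. norm (f x) \<le> C * inverse ((1 + norm x) ^ (2 * DIM('v)))"
  shows "integrable lborel f"
  by (rule Bochner_Integration.integrable_bound[where
        f = "\<lambda>x::'v. C * inverse ((1 + norm x) ^ (2 * DIM('v)))"])
     (use assms order_trans[OF norm_ge_zero assms(2)] in
       \<open>auto intro!: integrable_mult_right integrable_inverse_power_norm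
             simp: integrable_inverse_power_norm intro: order_trans[OF assms(2) abs_ge_self]\<close>)

text \<open>
  The difference quotients of \<open>f\<close> along \<open>b\<close> integrate to zero by translation invariance of Lebesgue
  measure. They converge to \<open>g\<close>, and the mean value theorem bounds them by the decay of \<open>g\<close>, because
  a translation by a vector of length at most 1 changes the weight only by a constant factor.
\<close>

lemma integral_dir_deriv_eq_0:
  fixes f g :: "'v::euclidean_space \<Rightarrow> complex"
  assumes f: "integrable lborel f" and g[measurable]: "g \<in> borel_measurable borel"
    and deriv: "\<And>x. ((\<lambda>t. f (x + t *\<^sub>R b)) has_vector_derivative g x) (at 0)"
    and bound: "\<And>x. norm (g x) \<le> C * inverse ((1 + norm x) ^ (2 * DIM('v)))"
    and b: "norm b \<le> 1"
  shows "integral\<^sup>L lborel g = 0"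
proof -
  let ?K = "2 * DIM('v)"
  define h where "h n = inverse (real (Suc n))" for n
  have h: "0 < h n" "h n \<le> 1" for n by (auto simp: h_def field_simps)
  have h0: "h \<longlonglongrightarrow> 0" unfolding h_def by (rule LIMSEQ_inverse_real_of_nat)
  have [measurable]: "f \<in> borel_measurable borel"
    using borel_measurable_integrable[OF f] by simp
  have C: "0 \<le> C" using order_trans[OF norm_ge_zero bound[of 0]] by simp
  have deriv': "((\<lambda>t. f (x + t *\<^sub>R b)) has_vector_derivative g (x + t *\<^sub>R b)) (at t)" for x t
  proof -
    have "((\<lambda>u. f ((x + t *\<^sub>R b) + u *\<^sub>R b)) has_vector_derivative g (x + t *\<^sub>R b)) (at (t - t))"
      using deriv[of "x + t *\<^sub>R b"] by simp
    then have "((\<lambda>u. f ((x + t *\<^sub>R b) + u *\<^sub>R b)) \<circ> (\<lambda>u. u - t)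
        has_vector_derivative 1 *\<^sub>R g (x + t *\<^sub>R b)) (at t)"
      by (intro vector_diff_chain_at) (auto intro!: derivative_eq_intros)
    then show ?thesis by (simp add: o_def algebra_simps)
  qed
  have diff: "norm (f (x + t *\<^sub>R b) - f x) \<le> C * 2 ^ ?K * inverse ((1 + norm x) ^ ?K) * t"
    if t: "0 < t" "t \<le> 1" for x t
  proof -
    have "norm (g (x + u *\<^sub>R b)) \<le> C * 2 ^ ?K * inverse ((1 + norm x) ^ ?K)"
      if u: "u \<in> {0..t}" for u
    proof -
      have "norm (u *\<^sub>R b) \<le> 1" using u t b by (simp add: mult_le_one)
      moreover have "norm x \<le> norm (x + u *\<^sub>R b) + norm (u *\<^sub>R b)"
        using norm_triangle_ineq4[of "x + u *\<^sub>R b" "u *\<^sub>R b"] by simp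
      ultimately have "1 + norm x \<le> 2 * (1 + norm (x + u *\<^sub>R b))"
        by (smt (verit) norm_ge_zero)
      then have "(1 + norm x) ^ ?K \<le> 2 ^ ?K * (1 + norm (x + u *\<^sub>R b)) ^ ?K"
        by (metis power_mono power_mult_distrib add_nonneg_nonneg norm_ge_zero zero_le_one)
      then have "inverse ((1 + norm (x + u *\<^sub>R b)) ^ ?K) \<le> 2 ^ ?K * inverse ((1 + norm x) ^ ?K)"
        by (simp add: field_simps add_pos_nonneg)
      from mult_left_mono[OF this C] bound[of "x + u *\<^sub>R b"] show ?thesis by (simp add: mult_ac)
    qed
    then have "norm (f (x + t *\<^sub>R b) - f (x + 0 *\<^sub>R b))
        \<le> C * 2 ^ ?K * inverse ((1 + norm x) ^ ?K) * norm (t - 0)"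
      using t
      by (intro differentiable_bound[where S = "{0..t}" and f' = "\<lambda>u h. h *\<^sub>R g (x + u *\<^sub>R b)"]
          has_derivative_at_withinI[OF deriv'[unfolded has_vector_derivative_def]] onorm_le)
         (auto simp: mult.commute intro!: mult_left_mono)
    then show ?thesis using t by simp
  qed
  have "(\<lambda>n. \<integral>x. (f (x + h n *\<^sub>R b) - f x) /\<^sub>R h n \<partial>lborel) \<longlonglongrightarrow> integral\<^sup>L lborel g"
  proof (rule integral_dominated_convergence)
    show "integrable lborel (\<lambda>x::'v. C * 2 ^ ?K * inverse ((1 + norm x) ^ ?K))"
      by (intro integrable_mult_right integrable_inverse_power_norm)
    show "AE x in lborel. (\<lambda>n. (f (x + h n *\<^sub>R b) - f x) /\<^sub>R h n) \<longlonglongrightarrow> g x"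
    proof (rule AE_I2)
      fix x
      have "((\<lambda>t. (f (x + t *\<^sub>R b) - f x) /\<^sub>R t) \<longlongrightarrow> g x) (at 0)"
      proof (rule LIM_zero_cancel, rule tendsto_norm_zero_cancel, rule Lim_transform_eventually)
        show "((\<lambda>t. norm (f (x + t *\<^sub>R b) - f x - t *\<^sub>R g x) / norm t) \<longlongrightarrow> 0) (at 0)"
          using deriv[of x] by (simp add: has_vector_derivative_def has_derivative_iff_norm)
        have "(f (x + t *\<^sub>R b) - f x) /\<^sub>R t - g x = (f (x + t *\<^sub>R b) - f x - t *\<^sub>R g x) /\<^sub>R t"
          if "t \<noteq> 0" for t
          using that by (simp add: scaleR_diff_right)
        then show "\<forall>\<^sub>F t in at 0. norm (f (x + t *\<^sub>R b) - f x - t *\<^sub>R g x) / norm t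
            = norm ((f (x + t *\<^sub>R b) - f x) /\<^sub>R t - g x)"
          by (auto simp: eventually_at_filter divide_inverse mult.commute)
      qed
      moreover have "filterlim h (at 0) sequentially"
        using h0 h(1) by (auto simp: filterlim_at intro!: always_eventually simp: less_imp_neq[OF h(1), THEN not_sym])
      ultimately show "(\<lambda>n. (f (x + h n *\<^sub>R b) - f x) /\<^sub>R h n) \<longlonglongrightarrow> g x"
        by (rule filterlim_compose)
    qed
    show "AE x in lborel. norm ((f (x + h n *\<^sub>R b) - f x) /\<^sub>R h n)
        \<le> C * 2 ^ ?K * inverse ((1 + norm x) ^ ?K)" for n
    proof (rule AE_I2)
      fix x :: 'v
      let ?M = "C * 2 ^ ?K * inverse ((1 + norm x) ^ ?K)"
      have "norm ((f (x + h n *\<^sub>R b) - f x) /\<^sub>R h n) = inverse (h n) * norm (f (x + h n *\<^sub>R b) - f x)"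
        using h(1)[of n] by simp
      also have "\<dots> \<le> inverse (h n) * (?M * h n)"
        using h(1)[of n] by (intro mult_left_mono diff h) auto
      also have "\<dots> = ?M" using h(1)[of n] by simp
      finally show "norm ((f (x + h n *\<^sub>R b) - f x) /\<^sub>R h n) \<le> ?M" .
    qed
  qed auto
  moreover have "(\<integral>x. (f (x + h n *\<^sub>R b) - f x) /\<^sub>R h n \<partial>lborel) = 0" for n
  proof -
    have "integrable lborel (\<lambda>x::'v. f (x + h n *\<^sub>R b))"
         "(\<integral>x. f (x + h n *\<^sub>R b) \<partial>lborel) = (\<integral>x. f x \<partial>lborel)"
      using f integrable_distr_eq[of "(+) (h n *\<^sub>R b)" lborel borel f]
        integral_distr[of "(+) (h n *\<^sub>R b)" lborel borel f]
      by (simp_all add: lborel_distr_plus add.commute)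
    then show ?thesis using f by (simp add: integral_diff)
  qed
  ultimately have "(\<lambda>n::nat. 0) \<longlonglongrightarrow> integral\<^sup>L lborel g" by (simp only:)
  then show ?thesis by (simp add: LIMSEQ_const_iff)
qed

section \<open>Schwartz functions\<close>

text \<open>
  Membership in the Schwartz space refers to all iterated derivatives at once. A set of rapidly
  decreasing functions that is closed under coordinate derivatives consists of Schwartz functions,
  so closure properties only need the first derivative, given as an expression of the same shape.
\<close>

lemma schwartz_coinduct:
  fixes S :: "('a::euclidean_space \<Rightarrow> complex) set"
  assumes "f \<in> S"
    and cont: "\<And>f. f \<in> S \<Longrightarrow> continuous_on UNIV f"
    and diff: "\<And>f b x. f \<in> S \<Longrightarrow> b \<in> Basis \<Longrightarrow> (\<lambda>t. f (x + t *\<^sub>R b)) differentiable at 0"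
    and deriv: "\<And>f b. f \<in> S \<Longrightarrow> b \<in> Basis \<Longrightarrow> dir_deriv b f \<in> S"
    and bdd: "\<And>f N. f \<in> S \<Longrightarrow> \<exists>C. \<forall>x. (1 + norm x) ^ N * norm (f x) \<le> C"
  shows "f \<in> schwartz"
proof -
  have S: "partials ds f \<in> S" if "set ds \<subseteq> Basis" for ds
    using that by (induction ds) (auto intro: assms)
  show ?thesis
    unfolding schwartz_def smooth_along_def bdd_above_def
    using cont[OF S] diff[OF S] bdd[OF S] by (auto intro: continuous_on_subset)
qed

lemma partials_snoc: "partials (ds @ [d]) f = partials ds (dir_deriv d f)"
  by (induction ds) auto

lemma schwartz_dir_deriv:
  assumes "f \<in> schwartz" "b \<in> Basis"
  shows "dir_deriv b f \<in> schwartz"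
proof -
  have *: "set (ds @ [b]) \<subseteq> Basis" if "set ds \<subseteq> Basis" for ds using that assms by auto
  show ?thesis
    using assms(1) * unfolding schwartz_def smooth_along_def
    by (auto simp: partials_snoc[symmetric] simp del: set_append)
qed

lemma schwartz_continuous: "f \<in> schwartz \<Longrightarrow> continuous_on UNIV f"
  unfolding schwartz_def smooth_along_def by (auto dest!: spec[of _ "[]"])

lemma schwartz_borel_measurable [measurable_dest]: "f \<in> schwartz \<Longrightarrow> f \<in> borel_measurable borel"
  by (rule borel_measurable_continuous_onI) (rule schwartz_continuous)

lemma schwartz_has_dir_deriv:
  assumes "f \<in> schwartz" "b \<in> Basis"
  shows "((\<lambda>t. f (x + t *\<^sub>R b)) has_vector_derivative dir_deriv b f x) (at 0)"
proof -
  have "(\<lambda>t. f (x + t *\<^sub>R b)) differentiable at 0"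
    using assms unfolding schwartz_def smooth_along_def by (auto dest!: spec[of _ "[]"])
  then show ?thesis
    unfolding dir_deriv_def by (simp add: vector_derivative_works)
qed

lemma dir_deriv_eqI:
  "((\<lambda>t. f (x + t *\<^sub>R b)) has_vector_derivative D) (at 0) \<Longrightarrow> dir_deriv b f x = D"
  unfolding dir_deriv_def by (rule vector_derivative_at)

lemma schwartz_decay:
  assumes "f \<in> schwartz"
  obtains C where "0 \<le> C" "\<And>x. (1 + norm x) ^ N * norm (f x) \<le> C"
proof -
  have "bdd_above (range (\<lambda>x. (1 + norm x) ^ N * norm (partials [] f x)))"
    using assms unfolding schwartz_def by (auto simp del: partials.simps)
  then obtain C where C: "\<And>x. (1 + norm x) ^ N * norm (f x) \<le> C"
    by (auto simp: bdd_above_def)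
  moreover have "0 \<le> C" by (rule order_trans[OF _ C[of 0]]) simp
  ultimately show thesis using that by blast
qed

lemma schwartz_decay_inverse:
  assumes "f \<in> schwartz"
  obtains C where "0 \<le> C" "\<And>x. norm (f x) \<le> C * inverse ((1 + norm x) ^ N)"
proof -
  from schwartz_decay[OF assms, of N] obtain C
    where "0 \<le> C" "\<And>x. (1 + norm x) ^ N * norm (f x) \<le> C" by blast
  moreover have "0 < (1 + norm x) ^ N" for x :: 'a by (simp add: add_pos_nonneg)
  ultimately show thesis by (intro that[of C]) (auto simp: field_simps)
qed

lemma schwartz_lincomb:
  assumes "f \<in> schwartz" "g \<in> schwartz"
  shows "(\<lambda>x. c * f x + d * g x) \<in> schwartz"
proof (rule schwartz_coinduct)
  define S :: "('a \<Rightarrow> complex) set" where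
    "S = {\<lambda>x. c * f x + d * g x | f g. f \<in> schwartz \<and> g \<in> schwartz}"
  show "(\<lambda>x. c * f x + d * g x) \<in> S" using assms unfolding S_def by blast
  fix h assume "h \<in> S"
  then obtain f g where h: "h = (\<lambda>x. c * f x + d * g x)" and f: "f \<in> schwartz" and g: "g \<in> schwartz"
    unfolding S_def by blast
  show "continuous_on UNIV h"
    unfolding h by (intro continuous_intros schwartz_continuous f g)
  show "\<exists>C. \<forall>x. (1 + norm x) ^ N * norm (h x) \<le> C" for N
  proof -
    from schwartz_decay[OF f, of N] schwartz_decay[OF g, of N] obtain A B where
      A: "\<And>x. (1 + norm x) ^ N * norm (f x) \<le> A" and B: "\<And>x. (1 + norm x) ^ N * norm (g x) \<le> B"
      by metis
    have "(1 + norm x) ^ N * norm (h x) \<le> norm c * A + norm d * B" for x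
    proof -
      have "(1 + norm x) ^ N * norm (h x) \<le> (1 + norm x) ^ N * (norm (c * f x) + norm (d * g x))"
        unfolding h by (intro mult_left_mono norm_triangle_ineq) auto
      also have "\<dots> = norm c * ((1 + norm x) ^ N * norm (f x)) + norm d * ((1 + norm x) ^ N * norm (g x))"
        by (simp add: norm_mult algebra_simps)
      also have "\<dots> \<le> norm c * A + norm d * B"
        by (intro add_mono mult_left_mono A B) auto
      finally show ?thesis .
    qed
    then show ?thesis by blast
  qed
  fix b :: 'a assume b: "b \<in> Basis"
  have D: "((\<lambda>t. h (x + t *\<^sub>R b)) has_vector_derivative (c * dir_deriv b f x + d * dir_deriv b g x)) (at 0)" for x
    unfolding h using b f g
    by (intro has_vector_derivative_add has_vector_derivative_mult_right schwartz_has_dir_deriv)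
  show "(\<lambda>t. h (x + t *\<^sub>R b)) differentiable at 0" for x
    using D by (rule differentiableI_vector)
  have "dir_deriv b h = (\<lambda>x. c * dir_deriv b f x + d * dir_deriv b g x)"
    using dir_deriv_eqI[OF D] by blast
  then show "dir_deriv b h \<in> S"
    unfolding S_def using schwartz_dir_deriv[OF f b] schwartz_dir_deriv[OF g b] by blast
qed

lemmas schwartz_add = schwartz_lincomb[where c = 1 and d = 1, simplified]

lemma schwartz_cmult: "f \<in> schwartz \<Longrightarrow> (\<lambda>x. c * f x) \<in> schwartz"
  using schwartz_lincomb[of f f c 0] by simp

lemma schwartz_zero: "(\<lambda>x. 0) \<in> schwartz"
  by (rule schwartz_coinduct[of _ "{\<lambda>x. 0}"]) (auto simp: fun_eq_iff intro!: dir_deriv_eqI)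

lemma schwartz_sum:
  assumes "\<And>i. i \<in> I \<Longrightarrow> f i \<in> schwartz"
  shows "(\<lambda>x. \<Sum>i\<in>I. f i x) \<in> schwartz"
  using assms by (induction I rule: infinite_finite_induct) (auto intro: schwartz_zero schwartz_add)

lemma has_dir_deriv_inner_mult:
  fixes f :: "'a::euclidean_space \<Rightarrow> complex"
  assumes "((\<lambda>t. f (x + t *\<^sub>R b)) has_vector_derivative D) (at 0)"
  shows "((\<lambda>t. of_real (l \<bullet> (x + t *\<^sub>R b)) * f (x + t *\<^sub>R b)) has_vector_derivative
      of_real (l \<bullet> x) * D + of_real (l \<bullet> b) * f x) (at 0)"
proof -
  have "((\<lambda>t. complex_of_real (l \<bullet> (x + t *\<^sub>R b))) has_vector_derivative of_real (l \<bullet> b)) (at 0)"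
    by (rule has_vector_derivative_of_real)
       (auto intro!: derivative_eq_intros simp: inner_add_right has_real_derivative_iff_has_vector_derivative[symmetric])
  from has_vector_derivative_mult[OF this assms] show ?thesis by simp
qed

text \<open>
  The functions \<open>l \<bullet> x * f x\<close> alone are not closed under derivatives: the product rule produces the
  extra term \<open>(l \<bullet> b) * f x\<close>. The coinduction therefore runs over sums with a Schwartz function.
\<close>

lemma schwartz_inner_mult:
  assumes "f \<in> schwartz"
  shows "(\<lambda>x. of_real (l \<bullet> x) * f x) \<in> schwartz"
proof (rule schwartz_coinduct)
  define S :: "('a \<Rightarrow> complex) set" where
    "S = {\<lambda>x. of_real (l \<bullet> x) * f x + g x | f g. f \<in> schwartz \<and> g \<in> schwartz}"
  have "(\<lambda>x. of_real (l \<bullet> x) * f x) = (\<lambda>x. of_real (l \<bullet> x) * f x + 0)" by simp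
  then show "(\<lambda>x. of_real (l \<bullet> x) * f x) \<in> S"
    using assms schwartz_zero unfolding S_def mem_Collect_eq by (intro exI conjI)
  fix h assume "h \<in> S"
  then obtain f g where h: "h = (\<lambda>x. of_real (l \<bullet> x) * f x + g x)" and f: "f \<in> schwartz" and g: "g \<in> schwartz"
    unfolding S_def by blast
  show "continuous_on UNIV h"
    unfolding h by (intro continuous_intros schwartz_continuous f g)
  show "\<exists>C. \<forall>x. (1 + norm x) ^ N * norm (h x) \<le> C" for N
  proof -
    from schwartz_decay[OF f, of "Suc N"] schwartz_decay[OF g, of N] obtain A B where
      A: "\<And>x. (1 + norm x) ^ Suc N * norm (f x) \<le> A" and B: "\<And>x. (1 + norm x) ^ N * norm (g x) \<le> B"
      by metis
    have "(1 + norm x) ^ N * norm (h x) \<le> norm l * A + B" for x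
    proof -
      have "\<bar>l \<bullet> x\<bar> \<le> norm l * (1 + norm x)"
        by (rule order_trans[OF Cauchy_Schwarz_ineq2]) (simp add: mult_left_mono)
      then have "norm (h x) \<le> (norm l * (1 + norm x)) * norm (f x) + norm (g x)"
        unfolding h by (intro order_trans[OF norm_triangle_ineq] add_right_mono)
          (simp add: norm_mult mult_right_mono)
      then have "(1 + norm x) ^ N * norm (h x)
          \<le> (1 + norm x) ^ N * ((norm l * (1 + norm x)) * norm (f x) + norm (g x))"
        by (intro mult_left_mono) auto
      also have "\<dots> = norm l * ((1 + norm x) ^ Suc N * norm (f x)) + (1 + norm x) ^ N * norm (g x)"
        by (simp add: algebra_simps)
      also have "\<dots> \<le> norm l * A + B"
        by (intro add_mono mult_left_mono A B) auto
      finally show ?thesis .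
    qed
    then show ?thesis by blast
  qed
  fix b :: 'a assume b: "b \<in> Basis"
  have D: "((\<lambda>t. h (x + t *\<^sub>R b)) has_vector_derivative
      ((of_real (l \<bullet> x) * dir_deriv b f x + of_real (l \<bullet> b) * f x) + dir_deriv b g x)) (at 0)" for x
    unfolding h using b f g
    by (intro has_vector_derivative_add has_dir_deriv_inner_mult schwartz_has_dir_deriv)
  show "(\<lambda>t. h (x + t *\<^sub>R b)) differentiable at 0" for x
    using D by (rule differentiableI_vector)
  have "dir_deriv b h = (\<lambda>x. of_real (l \<bullet> x) * dir_deriv b f x + (of_real (l \<bullet> b) * f x + 1 * dir_deriv b g x))"
    using dir_deriv_eqI[OF D] by (simp add: fun_eq_iff add.assoc)
  then show "dir_deriv b h \<in> S"
    unfolding S_def mem_Collect_eq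
    using schwartz_dir_deriv[OF f b] schwartz_lincomb[OF f schwartz_dir_deriv[OF g b]]
    by (intro exI conjI)
qed

text \<open>
  From \<open>1 + \<bar>v - u\<bar> \<le> (1 + \<bar>u\<bar>) * (1 + \<bar>v\<bar>)\<close>. Applied to \<open>u = q - p/2\<close> and \<open>v = q + p/2\<close> it gives decay in \<open>p\<close>
  with a constant independent of \<open>q\<close>, which makes the Wigner function bounded.
\<close>

lemma schwartz_mult_decay:
  fixes f g :: "'a::euclidean_space \<Rightarrow> complex"
  assumes "f \<in> schwartz" "g \<in> schwartz"
  obtains C where "0 \<le> C"
    "\<And>u v. norm (f u * g v) \<le> C * inverse ((1 + norm (v - u)) ^ N)"
proof -
  from schwartz_decay_inverse[OF assms(1), of N] schwartz_decay_inverse[OF assms(2), of N]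
  obtain A B where A: "0 \<le> A" "\<And>x. norm (f x) \<le> A * inverse ((1 + norm x) ^ N)"
    and B: "0 \<le> B" "\<And>x. norm (g x) \<le> B * inverse ((1 + norm x) ^ N)" by metis
  have "norm (f u * g v) \<le> A * B * inverse ((1 + norm (v - u)) ^ N)" for u v
  proof -
    have "1 + norm (v - u) \<le> 1 + (norm u + norm v)"
      using norm_triangle_ineq4[of v u] by simp
    also have "\<dots> \<le> (1 + norm u) * (1 + norm v)" by (simp add: algebra_simps)
    finally have "(1 + norm (v - u)) ^ N \<le> ((1 + norm u) * (1 + norm v)) ^ N"
      by (intro power_mono) auto
    then have "inverse (((1 + norm u) * (1 + norm v)) ^ N) \<le> inverse ((1 + norm (v - u)) ^ N)"
      by (intro le_imp_inverse_le) (auto simp: add_pos_nonneg)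
    then have "A * B * inverse (((1 + norm u) * (1 + norm v)) ^ N)
        \<le> A * B * inverse ((1 + norm (v - u)) ^ N)"
      by (intro mult_left_mono) (auto simp: A B)
    moreover have "norm (f u * g v) \<le> (A * inverse ((1 + norm u) ^ N)) * (B * inverse ((1 + norm v) ^ N))"
      unfolding norm_mult by (intro mult_mono A B mult_nonneg_nonneg) auto
    ultimately show ?thesis by (simp add: power_mult_distrib mult_ac)
  qed
  then show thesis using A(1) B(1) by (intro that[of "A * B"]) auto
qed

lemma schwartz_mult_decay_inverse:
  assumes "f \<in> schwartz" "g \<in> schwartz"
  obtains C where "\<And>x. norm (f x * g x) \<le> C * inverse ((1 + norm x) ^ N)"
proof -
  from schwartz_decay_inverse[OF assms(1)] obtain A where
    A: "0 \<le> A" "\<And>x. norm (f x) \<le> A * inverse ((1 + norm x) ^ N)" by blast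
  from schwartz_decay[OF assms(2), of 0] obtain B where "0 \<le> B" "\<And>x. norm (g x) \<le> B" by auto
  then have "norm (f x * g x) \<le> (A * B) * inverse ((1 + norm x) ^ N)" for x
    using mult_mono[OF A(2)[of x], of "norm (g x)" B] A(1) by (simp add: norm_mult mult_ac)
  then show thesis by (rule that)
qed

lemma schwartz_mult_integrable:
  assumes "f \<in> schwartz" "g \<in> schwartz"
  shows "integrable lborel (\<lambda>x. f x * g x)"
proof -
  from schwartz_mult_decay_inverse[OF assms] obtain C
    where "\<And>x. norm (f x * g x) \<le> C * inverse ((1 + norm x) ^ (2 * DIM('a)))" by blast
  then show ?thesis
    using assms[THEN schwartz_borel_measurable] by (intro integrable_if_decay) auto
qed

lemma schwartz_integral_by_parts:
  fixes f g :: "'a::euclidean_space \<Rightarrow> complex"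
  assumes f: "f \<in> schwartz" and g: "g \<in> schwartz" and b: "b \<in> Basis"
  shows "(\<integral>x. dir_deriv b f x * g x \<partial>lborel) = - (\<integral>x. f x * dir_deriv b g x \<partial>lborel)"
proof -
  let ?D = "\<lambda>x. f x * dir_deriv b g x + dir_deriv b f x * g x"
  let ?K = "2 * DIM('a)"
  note f' = schwartz_dir_deriv[OF f b] and g' = schwartz_dir_deriv[OF g b]
  from schwartz_mult_decay_inverse[OF f g', of ?K] schwartz_mult_decay_inverse[OF f' g, of ?K]
  obtain A B where
    "\<And>x. norm (f x * dir_deriv b g x) \<le> A * inverse ((1 + norm x) ^ ?K)"
    "\<And>x. norm (dir_deriv b f x * g x) \<le> B * inverse ((1 + norm x) ^ ?K)" by metis
  then have bound: "norm (?D x) \<le> (A + B) * inverse ((1 + norm x) ^ ?K)" for x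
    unfolding distrib_right by (intro norm_triangle_le add_mono)
  have "integral\<^sup>L lborel ?D = 0"
  proof (rule integral_dir_deriv_eq_0[OF schwartz_mult_integrable[OF f g] _ _ bound])
    show "?D \<in> borel_measurable borel"
      using f g f' g' by measurable
    show "((\<lambda>t. f (x + t *\<^sub>R b) * g (x + t *\<^sub>R b)) has_vector_derivative ?D x) (at 0)" for x
      using has_vector_derivative_mult[OF schwartz_has_dir_deriv[OF f b, of x] schwartz_has_dir_deriv[OF g b, of x]]
      by simp
  qed (use b in auto)
  then show ?thesis
    using schwartz_mult_integrable[OF f g'] schwartz_mult_integrable[OF f' g]
    by (simp add: eq_neg_iff_add_eq_0 add.commute)
qed

section \<open>Quantised linear forms and the Wigner function\<close>

text \<open>
  The Weyl quantisation of the linear form \<open>z \<mapsto> c \<bullet> z\<close> on phase space: multiplication by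
  \<open>fst c \<bullet> x\<close> plus \<open>-\<i>\<close> times the derivative along \<open>snd c\<close>. The derivative is spelled out in coordinates
  because Schwartz functions come with derivatives along basis vectors only.
\<close>

definition quant_form :: "'v::euclidean_space \<times> 'v \<Rightarrow> ('v \<Rightarrow> complex) \<Rightarrow> 'v \<Rightarrow> complex" where
  "quant_form c \<psi> = (\<lambda>x. of_real (fst c \<bullet> x) * \<psi> x
     - \<i> * (\<Sum>b\<in>Basis. of_real (snd c \<bullet> b) * dir_deriv b \<psi> x))"

text \<open>
  Integration by parts changes the sign of the derivative, so the transpose with respect to the
  bilinear pairing (no complex conjugate) flips the momentum component of the form.
\<close>

definition form_transpose :: "'v::euclidean_space \<times> 'v \<Rightarrow> 'v \<times> 'v" where
  "form_transpose c = (fst c, - snd c)"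

lemma schwartz_quant_form: "\<psi> \<in> schwartz \<Longrightarrow> quant_form c \<psi> \<in> schwartz"
  unfolding quant_form_def
  using schwartz_lincomb[OF schwartz_inner_mult[of \<psi> "fst c"]
      schwartz_sum[of Basis "\<lambda>b x. of_real (snd c \<bullet> b) * dir_deriv b \<psi> x"], of 1 "- \<i>"]
  by (simp add: schwartz_cmult schwartz_dir_deriv)

lemma integral_quant_form_transpose:
  fixes \<psi> \<phi> :: "'v::euclidean_space \<Rightarrow> complex"
  assumes \<psi>: "\<psi> \<in> schwartz" and \<phi>: "\<phi> \<in> schwartz"
  shows "(\<integral>x. quant_form c \<psi> x * \<phi> x \<partial>lborel) = (\<integral>x. \<psi> x * quant_form (form_transpose c) \<phi> x \<partial>lborel)"
proof -
  note int = schwartz_mult_integrable[OF schwartz_inner_mult[OF \<psi>, of "fst c"] \<phi>]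
    schwartz_mult_integrable[OF \<psi> schwartz_inner_mult[OF \<phi>, of "fst c"]]
  have int': "integrable lborel (\<lambda>x. of_real (snd c \<bullet> b) * (dir_deriv b \<psi> x * \<phi> x))"
    "integrable lborel (\<lambda>x. of_real (snd c \<bullet> b) * (\<psi> x * dir_deriv b \<phi> x))" if "b \<in> Basis" for b
    using schwartz_mult_integrable[OF schwartz_dir_deriv[OF \<psi> that] \<phi>]
      schwartz_mult_integrable[OF \<psi> schwartz_dir_deriv[OF \<phi> that]] by auto
  have "(\<integral>x. quant_form c \<psi> x * \<phi> x \<partial>lborel)
     = (\<integral>x. (of_real (fst c \<bullet> x) * \<psi> x) * \<phi> x
          - \<i> * (\<Sum>b\<in>Basis. of_real (snd c \<bullet> b) * (dir_deriv b \<psi> x * \<phi> x)) \<partial>lborel)"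
    unfolding quant_form_def by (simp add: left_diff_distrib sum_distrib_right mult.assoc)
  also have "\<dots> = (\<integral>x. (of_real (fst c \<bullet> x) * \<psi> x) * \<phi> x \<partial>lborel)
          - \<i> * (\<Sum>b\<in>Basis. of_real (snd c \<bullet> b) * (\<integral>x. dir_deriv b \<psi> x * \<phi> x \<partial>lborel))"
    using int int' by (simp add: Bochner_Integration.integral_diff Bochner_Integration.integral_sum)
  also have "\<dots> = (\<integral>x. \<psi> x * (of_real (fst c \<bullet> x) * \<phi> x) \<partial>lborel)
          + \<i> * (\<Sum>b\<in>Basis. of_real (snd c \<bullet> b) * (\<integral>x. \<psi> x * dir_deriv b \<phi> x \<partial>lborel))"
    by (simp add: schwartz_integral_by_parts[OF \<psi> \<phi>] sum_negf mult.assoc mult.left_commute[of "\<psi> _"])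
  also have "\<dots> = (\<integral>x. \<psi> x * (of_real (fst c \<bullet> x) * \<phi> x)
          + \<i> * (\<Sum>b\<in>Basis. of_real (snd c \<bullet> b) * (\<psi> x * dir_deriv b \<phi> x)) \<partial>lborel)"
    using int int' by (simp add: Bochner_Integration.integral_add Bochner_Integration.integral_sum)
  also have "\<dots> = (\<integral>x. \<psi> x * quant_form (form_transpose c) \<phi> x \<partial>lborel)"
    unfolding quant_form_def form_transpose_def by (simp add: algebra_simps sum_distrib_left sum_negf)
  finally show ?thesis .
qed

abbreviation wigner_kernel ::
  "('v::euclidean_space \<Rightarrow> complex) \<Rightarrow> ('v \<Rightarrow> complex) \<Rightarrow> 'v \<Rightarrow> 'v \<Rightarrow> complex" where
  "wigner_kernel \<psi> \<phi> q p \<equiv> \<psi> (q - p /\<^sub>R 2) * \<phi> (q + p /\<^sub>R 2)"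

lemma wigner_eq:
  "wigner \<psi> \<phi> (q, \<xi>) = (\<integral>p. exp (\<i> * of_real (p \<bullet> \<xi>)) * wigner_kernel \<psi> \<phi> q p \<partial>lborel)"
  by (simp add: wigner_def mult.assoc)

lemma wigner_kernel_decay:
  fixes \<psi> \<phi> :: "'v::euclidean_space \<Rightarrow> complex"
  assumes "\<psi> \<in> schwartz" "\<phi> \<in> schwartz"
  obtains C where "0 \<le> C" "\<And>q p. norm (wigner_kernel \<psi> \<phi> q p) \<le> C * inverse ((1 + norm p) ^ N)"
proof -
  from schwartz_mult_decay[OF assms, of N] obtain C where C: "0 \<le> C"
    "\<And>u v. norm (\<psi> u * \<phi> v) \<le> C * inverse ((1 + norm (v - u)) ^ N)" by blast
  have "(q + p /\<^sub>R 2) - (q - p /\<^sub>R 2) = p" for q p :: 'v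
    by (simp add: scaleR_left_distrib[symmetric])
  then show thesis using C(2)[of "_ - _ /\<^sub>R 2" "_ + _ /\<^sub>R 2"] C(1)
    by (intro that[of C]) (metis)+
qed

lemma wigner_kernel_measurable:
  assumes "\<psi> \<in> schwartz" "\<phi> \<in> schwartz"
  shows "wigner_kernel \<psi> \<phi> q \<in> borel_measurable borel"
  by (intro borel_measurable_continuous_onI continuous_intros
       continuous_on_compose2[OF schwartz_continuous[OF assms(1)]]
       continuous_on_compose2[OF schwartz_continuous[OF assms(2)]]) auto

lemma wigner_integrand_integrable:
  assumes "\<psi> \<in> schwartz" "\<phi> \<in> schwartz"
  shows "integrable lborel (\<lambda>p. exp (\<i> * of_real (p \<bullet> \<xi>)) * wigner_kernel \<psi> \<phi> q p)"
proof -
  from wigner_kernel_decay[OF assms, of "2 * DIM('a)"] obtain C where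
    "\<And>q p. norm (wigner_kernel \<psi> \<phi> q p) \<le> C * inverse ((1 + norm p) ^ (2 * DIM('a)))" by blast
  moreover note [measurable] = wigner_kernel_measurable[OF assms]
  ultimately show ?thesis by (intro integrable_if_decay) (auto simp: norm_mult)
qed

lemma wigner_bounded:
  fixes \<psi> \<phi> :: "'v::euclidean_space \<Rightarrow> complex"
  assumes "\<psi> \<in> schwartz" "\<phi> \<in> schwartz"
  shows "\<exists>C. \<forall>z. norm (wigner \<psi> \<phi> z) \<le> C"
proof -
  let ?w = "\<lambda>p::'v. inverse ((1 + norm p) ^ (2 * DIM('v)))"
  from wigner_kernel_decay[OF assms, of "2 * DIM('v)"] obtain C where
    C: "\<And>q p. norm (wigner_kernel \<psi> \<phi> q p) \<le> C * ?w p" by blast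
  have "norm (wigner \<psi> \<phi> (q, \<xi>)) \<le> (\<integral>p. C * ?w p \<partial>lborel)" for q \<xi>
    unfolding wigner_eq
    by (intro Bochner_Integration.integral_norm_bound_integral wigner_integrand_integrable assms
         integrable_mult_right integrable_inverse_power_norm) (use C in \<open>simp add: norm_mult\<close>)
  then show ?thesis by auto
qed

lemma wigner_measurable:
  fixes \<psi> \<phi> :: "'v::euclidean_space \<Rightarrow> complex"
  assumes "\<psi> \<in> schwartz" "\<phi> \<in> schwartz"
  shows "wigner \<psi> \<phi> \<in> borel_measurable borel"
proof -
  have "continuous_on UNIV (\<lambda>(z, p). exp (\<i> * of_real (p \<bullet> snd z)) * wigner_kernel \<psi> \<phi> (fst z) p)"
    unfolding case_prod_unfold
    by (intro continuous_intros continuous_on_compose2[OF schwartz_continuous[OF assms(1)]]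
       continuous_on_compose2[OF schwartz_continuous[OF assms(2)]]) auto
  then have "(\<lambda>(z, p). exp (\<i> * of_real (p \<bullet> snd z)) * wigner_kernel \<psi> \<phi> (fst z) p)
      \<in> borel_measurable ((borel :: ('v \<times> 'v) measure) \<Otimes>\<^sub>M lborel)"
    using borel_measurable_continuous_onI
    by (subst measurable_cong_sets[OF sets_pair_measure_cong[OF refl sets_lborel] refl], subst borel_prod) auto
  from lborel.borel_measurable_lebesgue_integral[OF this]
  have "(\<lambda>z. \<integral>p. exp (\<i> * of_real (p \<bullet> snd z)) * wigner_kernel \<psi> \<phi> (fst z) p \<partial>lborel)
      \<in> borel_measurable (borel :: ('v \<times> 'v) measure)" by simp
  then show ?thesis by (simp add: wigner_def case_prod_unfold mult.assoc)
qed

lemma wigner_lincomb: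
  assumes "\<psi> \<in> schwartz" "\<psi>' \<in> schwartz" "\<phi> \<in> schwartz"
  shows "wigner (\<lambda>x. a * \<psi> x + b * \<psi>' x) \<phi> z = a * wigner \<psi> \<phi> z + b * wigner \<psi>' \<phi> z"
    and "wigner \<phi> (\<lambda>x. a * \<psi> x + b * \<psi>' x) z = a * wigner \<phi> \<psi> z + b * wigner \<phi> \<psi>' z"
proof -
  obtain q \<xi> where z: "z = (q, \<xi>)" by fastforce
  note int = wigner_integrand_integrable[OF assms(1,3), of \<xi> q] wigner_integrand_integrable[OF assms(2,3), of \<xi> q]
    wigner_integrand_integrable[OF assms(3,1), of \<xi> q] wigner_integrand_integrable[OF assms(3,2), of \<xi> q]
  have "wigner (\<lambda>x. a * \<psi> x + b * \<psi>' x) \<phi> z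
    = (\<integral>p. a * (exp (\<i> * of_real (p \<bullet> \<xi>)) * wigner_kernel \<psi> \<phi> q p)
          + b * (exp (\<i> * of_real (p \<bullet> \<xi>)) * wigner_kernel \<psi>' \<phi> q p) \<partial>lborel)"
    unfolding z wigner_eq by (simp add: algebra_simps)
  also have "\<dots> = a * wigner \<psi> \<phi> z + b * wigner \<psi>' \<phi> z"
    unfolding z wigner_eq using int by (subst Bochner_Integration.integral_add) auto
  finally show "wigner (\<lambda>x. a * \<psi> x + b * \<psi>' x) \<phi> z = a * wigner \<psi> \<phi> z + b * wigner \<psi>' \<phi> z" .
  have "wigner \<phi> (\<lambda>x. a * \<psi> x + b * \<psi>' x) z
    = (\<integral>p. a * (exp (\<i> * of_real (p \<bullet> \<xi>)) * wigner_kernel \<phi> \<psi> q p)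
          + b * (exp (\<i> * of_real (p \<bullet> \<xi>)) * wigner_kernel \<phi> \<psi>' q p) \<partial>lborel)"
    unfolding z wigner_eq by (simp add: algebra_simps)
  also have "\<dots> = a * wigner \<phi> \<psi> z + b * wigner \<phi> \<psi>' z"
    unfolding z wigner_eq using int by (subst Bochner_Integration.integral_add) auto
  finally show "wigner \<phi> (\<lambda>x. a * \<psi> x + b * \<psi>' x) z = a * wigner \<phi> \<psi> z + b * wigner \<phi> \<psi>' z" .
qed

lemma wigner_sum:
  assumes "finite I" "\<And>i. i \<in> I \<Longrightarrow> f i \<in> schwartz" "\<phi> \<in> schwartz"
  shows "wigner (\<lambda>x. \<Sum>i\<in>I. a i * f i x) \<phi> z = (\<Sum>i\<in>I. a i * wigner (f i) \<phi> z)"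
    and "wigner \<phi> (\<lambda>x. \<Sum>i\<in>I. a i * f i x) z = (\<Sum>i\<in>I. a i * wigner \<phi> (f i) z)"
proof -
  have "(\<lambda>x. \<Sum>i\<in>J. a i * f i x) \<in> schwartz" if "J \<subseteq> I" for J
    using assms that by (intro schwartz_sum schwartz_cmult) auto
  with assms(1,2) have "wigner (\<lambda>x. \<Sum>i\<in>I. a i * f i x) \<phi> z = (\<Sum>i\<in>I. a i * wigner (f i) \<phi> z) \<and>
    wigner \<phi> (\<lambda>x. \<Sum>i\<in>I. a i * f i x) z = (\<Sum>i\<in>I. a i * wigner \<phi> (f i) z)"
  proof (induction I rule: finite_induct)
    case empty
    then show ?case by (simp add: wigner_def case_prod_unfold)
  next
    case (insert i I)
    have I: "(\<lambda>x. \<Sum>i\<in>I. a i * f i x) \<in> schwartz" by (rule insert.prems) auto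
    have i: "f i \<in> schwartz" by (rule insert.prems) auto
    have "wigner (\<lambda>x. \<Sum>i\<in>I. a i * f i x) \<phi> z = (\<Sum>i\<in>I. a i * wigner (f i) \<phi> z) \<and>
      wigner \<phi> (\<lambda>x. \<Sum>i\<in>I. a i * f i x) z = (\<Sum>i\<in>I. a i * wigner \<phi> (f i) z)"
      by (rule insert.IH) (auto intro: insert.prems)
    then show ?case
      using insert.hyps wigner_lincomb[OF i I assms(3), of "a i" 1 z] by simp
  qed
  then show "wigner (\<lambda>x. \<Sum>i\<in>I. a i * f i x) \<phi> z = (\<Sum>i\<in>I. a i * wigner (f i) \<phi> z)"
    "wigner \<phi> (\<lambda>x. \<Sum>i\<in>I. a i * f i x) z = (\<Sum>i\<in>I. a i * wigner \<phi> (f i) z)" by auto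
qed

lemma wigner_quant_form_expand:
  assumes \<psi>: "\<psi> \<in> schwartz" and \<phi>: "\<phi> \<in> schwartz"
  shows "wigner (quant_form c \<psi>) \<phi> z = wigner (\<lambda>x. of_real (fst c \<bullet> x) * \<psi> x) \<phi> z
      - \<i> * (\<Sum>b\<in>Basis. of_real (snd c \<bullet> b) * wigner (dir_deriv b \<psi>) \<phi> z)"
    and "wigner \<phi> (quant_form c \<psi>) z = wigner \<phi> (\<lambda>x. of_real (fst c \<bullet> x) * \<psi> x) z
      - \<i> * (\<Sum>b\<in>Basis. of_real (snd c \<bullet> b) * wigner \<phi> (dir_deriv b \<psi>) z)"
proof -
  let ?m = "\<lambda>x. of_real (fst c \<bullet> x) * \<psi> x" and ?s = "\<lambda>x. \<Sum>b\<in>Basis. of_real (snd c \<bullet> b) * dir_deriv b \<psi> x"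
  have eq: "quant_form c \<psi> = (\<lambda>x. 1 * ?m x + (- \<i>) * ?s x)" by (simp add: quant_form_def)
  have s: "?s \<in> schwartz" by (rule schwartz_sum, rule schwartz_cmult, rule schwartz_dir_deriv[OF \<psi>])
  note m = schwartz_inner_mult[OF \<psi>, of "fst c"]
  have wsum: "wigner ?s \<phi> z = (\<Sum>b\<in>Basis. of_real (snd c \<bullet> b) * wigner (dir_deriv b \<psi>) \<phi> z)"
    "wigner \<phi> ?s z = (\<Sum>b\<in>Basis. of_real (snd c \<bullet> b) * wigner \<phi> (dir_deriv b \<psi>) z)"
    using wigner_sum[of Basis "\<lambda>b. dir_deriv b \<psi>" \<phi> "\<lambda>b. of_real (snd c \<bullet> b)" z]
      schwartz_dir_deriv[OF \<psi>] \<phi> by simp_all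
  show "wigner (quant_form c \<psi>) \<phi> z = wigner ?m \<phi> z
      - \<i> * (\<Sum>b\<in>Basis. of_real (snd c \<bullet> b) * wigner (dir_deriv b \<psi>) \<phi> z)"
    unfolding eq wigner_lincomb(1)[OF m s \<phi>]
    by (simp add: wsum)
  show "wigner \<phi> (quant_form c \<psi>) z = wigner \<phi> ?m z
      - \<i> * (\<Sum>b\<in>Basis. of_real (snd c \<bullet> b) * wigner \<phi> (dir_deriv b \<psi>) z)"
    unfolding eq wigner_lincomb(2)[OF m s \<phi>]
    by (simp add: wsum)
qed

lemma wigner_mult_position:
  assumes \<psi>: "\<psi> \<in> schwartz" and \<phi>: "\<phi> \<in> schwartz"
  shows "2 * of_real (l \<bullet> q) * wigner \<psi> \<phi> (q, \<xi>)
    = wigner (\<lambda>x. of_real (l \<bullet> x) * \<psi> x) \<phi> (q, \<xi>) + wigner \<psi> (\<lambda>x. of_real (l \<bullet> x) * \<phi> x) (q, \<xi>)"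
proof -
  let ?e = "\<lambda>p. exp (\<i> * complex_of_real (p \<bullet> \<xi>))"
  let ?m = "\<lambda>f x. of_real (l \<bullet> x) * f x :: complex"
  have "wigner (?m \<psi>) \<phi> (q, \<xi>) + wigner \<psi> (?m \<phi>) (q, \<xi>)
     = (\<integral>p. ?e p * wigner_kernel (?m \<psi>) \<phi> q p + ?e p * wigner_kernel \<psi> (?m \<phi>) q p \<partial>lborel)"
    unfolding wigner_eq
    by (intro Bochner_Integration.integral_add[symmetric] wigner_integrand_integrable schwartz_inner_mult \<psi> \<phi>)
  also have "\<dots> = (\<integral>p. (2 * of_real (l \<bullet> q)) * (?e p * wigner_kernel \<psi> \<phi> q p) \<partial>lborel)"
    by (rule Bochner_Integration.integral_cong) (auto simp: inner_diff_right inner_add_right algebra_simps)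
  also have "\<dots> = 2 * of_real (l \<bullet> q) * wigner \<psi> \<phi> (q, \<xi>)"
    unfolding wigner_eq using wigner_integrand_integrable[OF \<psi> \<phi>, of \<xi> q] by simp
  finally show ?thesis ..
qed

lemma has_dir_deriv_scaled:
  assumes "((\<lambda>t. f (y + t *\<^sub>R b)) has_vector_derivative D) (at 0)"
  shows "((\<lambda>t. f (y + (r * t) *\<^sub>R b)) has_vector_derivative r *\<^sub>R D) (at 0)"
proof -
  have "((\<lambda>t. f (y + t *\<^sub>R b)) \<circ> (\<lambda>t. r * t) has_vector_derivative r *\<^sub>R D) (at 0)"
    by (rule vector_diff_chain_at) (use assms in \<open>auto intro!: derivative_eq_intros\<close>)
  then show ?thesis by (simp add: o_def)
qed

text \<open>
  The integrand of the Wigner transform, as a function of \<open>p\<close>, has a derivative that integrates to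
  zero. That derivative consists of the exponential factor, which brings down \<open>\<i> * (b \<bullet> \<xi>)\<close>, and of the
  two factors \<open>\<psi> (q - p/2)\<close> and \<open>\<phi> (q + p/2)\<close>, whose inner derivatives are \<open>-1/2\<close> and \<open>1/2\<close>.
\<close>

lemma wigner_mult_momentum:
  fixes \<psi> \<phi> :: "'v::euclidean_space \<Rightarrow> complex"
  assumes \<psi>: "\<psi> \<in> schwartz" and \<phi>: "\<phi> \<in> schwartz" and b: "b \<in> Basis"
  shows "2 * of_real (b \<bullet> \<xi>) * wigner \<psi> \<phi> (q, \<xi>)
    = \<i> * wigner \<psi> (dir_deriv b \<phi>) (q, \<xi>) - \<i> * wigner (dir_deriv b \<psi>) \<phi> (q, \<xi>)"
proof -
  let ?e = "\<lambda>p. exp (\<i> * complex_of_real (p \<bullet> \<xi>))"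
  let ?K = "2 * DIM('v)"
  note \<psi>' = schwartz_dir_deriv[OF \<psi> b] and \<phi>' = schwartz_dir_deriv[OF \<phi> b]
  let ?g = "\<lambda>p. \<i> * of_real (b \<bullet> \<xi>) * (?e p * wigner_kernel \<psi> \<phi> q p)
      - (1/2) * (?e p * wigner_kernel (dir_deriv b \<psi>) \<phi> q p)
      + (1/2) * (?e p * wigner_kernel \<psi> (dir_deriv b \<phi>) q p)"
  have deriv: "((\<lambda>t. ?e (p + t *\<^sub>R b) * wigner_kernel \<psi> \<phi> q (p + t *\<^sub>R b))
      has_vector_derivative ?g p) (at 0)" for p
  proof -
    have e: "((\<lambda>t. ?e (p + t *\<^sub>R b)) has_vector_derivative ?e p * (\<i> * of_real (b \<bullet> \<xi>))) (at 0)"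
    proof -
      have "((\<lambda>z. exp (\<i> * (of_real (p \<bullet> \<xi>) + z * of_real (b \<bullet> \<xi>)))) has_field_derivative
          ?e p * (\<i> * of_real (b \<bullet> \<xi>))) (at (of_real 0))"
        by (auto intro!: derivative_eq_intros)
      from has_vector_derivative_real_field[OF this] show ?thesis by (simp add: inner_add_left)
    qed
    have 1: "((\<lambda>t. \<psi> (q - (p + t *\<^sub>R b) /\<^sub>R 2)) has_vector_derivative
        (-1/2) *\<^sub>R dir_deriv b \<psi> (q - p /\<^sub>R 2)) (at 0)"
      using has_dir_deriv_scaled[OF schwartz_has_dir_deriv[OF \<psi> b, of "q - p /\<^sub>R 2"], of "-1/2"]
      by (simp add: algebra_simps)
    have 2: "((\<lambda>t. \<phi> (q + (p + t *\<^sub>R b) /\<^sub>R 2)) has_vector_derivative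
        (1/2) *\<^sub>R dir_deriv b \<phi> (q + p /\<^sub>R 2)) (at 0)"
      using has_dir_deriv_scaled[OF schwartz_has_dir_deriv[OF \<phi> b, of "q + p /\<^sub>R 2"], of "1/2"]
      by (simp add: algebra_simps)
    show ?thesis
      by (rule has_vector_derivative_eq_rhs[OF has_vector_derivative_mult[OF e has_vector_derivative_mult[OF 1 2]]])
         (simp add: algebra_simps scaleR_conv_of_real)
  qed
  note int = wigner_integrand_integrable[OF \<psi> \<phi>, of \<xi> q]
    wigner_integrand_integrable[OF \<psi>' \<phi>, of \<xi> q] wigner_integrand_integrable[OF \<psi> \<phi>', of \<xi> q]
  from wigner_kernel_decay[OF \<psi> \<phi>, of ?K] wigner_kernel_decay[OF \<psi>' \<phi>, of ?K]
    wigner_kernel_decay[OF \<psi> \<phi>', of ?K]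
  obtain A B C where
    A: "\<And>q p. norm (wigner_kernel \<psi> \<phi> q p) \<le> A * inverse ((1 + norm p) ^ ?K)" and
    B: "\<And>q p. norm (wigner_kernel (dir_deriv b \<psi>) \<phi> q p) \<le> B * inverse ((1 + norm p) ^ ?K)" and
    C: "\<And>q p. norm (wigner_kernel \<psi> (dir_deriv b \<phi>) q p) \<le> C * inverse ((1 + norm p) ^ ?K)" by metis
  have bound: "norm (?g p) \<le> (\<bar>b \<bullet> \<xi>\<bar> * A + (1/2) * B + (1/2) * C) * inverse ((1 + norm p) ^ ?K)" for p
  proof -
    have "norm (?g p) \<le> \<bar>b \<bullet> \<xi>\<bar> * norm (wigner_kernel \<psi> \<phi> q p)
       + (1/2) * norm (wigner_kernel (dir_deriv b \<psi>) \<phi> q p)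
       + (1/2) * norm (wigner_kernel \<psi> (dir_deriv b \<phi>) q p)"
      by (rule order_trans[OF norm_triangle_ineq], rule add_mono, rule order_trans[OF norm_triangle_ineq4])
         (simp_all add: norm_mult)
    also have "\<dots> \<le> \<bar>b \<bullet> \<xi>\<bar> * (A * inverse ((1 + norm p) ^ ?K)) + (1/2) * (B * inverse ((1 + norm p) ^ ?K))
       + (1/2) * (C * inverse ((1 + norm p) ^ ?K))"
      by (intro add_mono mult_left_mono A B C) auto
    finally show ?thesis by (simp add: algebra_simps)
  qed
  have "integral\<^sup>L lborel ?g = 0"
    by (rule integral_dir_deriv_eq_0[OF int(1) _ deriv bound])
       (use borel_measurable_integrable[OF int(1)] borel_measurable_integrable[OF int(2)]
          borel_measurable_integrable[OF int(3)] b in \<open>auto intro!: borel_measurable_add borel_measurable_diff borel_measurable_times\<close>)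
  moreover have "integral\<^sup>L lborel ?g = \<i> * of_real (b \<bullet> \<xi>) * wigner \<psi> \<phi> (q, \<xi>)
      - (1/2) * wigner (dir_deriv b \<psi>) \<phi> (q, \<xi>) + (1/2) * wigner \<psi> (dir_deriv b \<phi>) (q, \<xi>)"
    unfolding wigner_eq using int
    by (subst Bochner_Integration.integral_add, force, force, subst Bochner_Integration.integral_diff) auto
  ultimately have "\<i> * of_real (b \<bullet> \<xi>) * wigner \<psi> \<phi> (q, \<xi>)
      = (1/2) * wigner (dir_deriv b \<psi>) \<phi> (q, \<xi>) - (1/2) * wigner \<psi> (dir_deriv b \<phi>) (q, \<xi>)"
    by (simp add: algebra_simps)
  then have "(-2 * \<i>) * (\<i> * of_real (b \<bullet> \<xi>) * wigner \<psi> \<phi> (q, \<xi>))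
      = (-2 * \<i>) * ((1/2) * wigner (dir_deriv b \<psi>) \<phi> (q, \<xi>) - (1/2) * wigner \<psi> (dir_deriv b \<phi>) (q, \<xi>))"
    by simp
  then show ?thesis by (simp add: algebra_simps)
qed

text \<open>
  The Wigner transform turns multiplication by a linear form on phase space into the average of its
  quantisation acting on \<open>\<psi>\<close> and the transpose acting on \<open>\<phi>\<close>. All later statements about the Wigner
  function (its decay, and the Weyl symbols) come from iterating this identity.
\<close>

lemma wigner_mult_linear:
  assumes \<psi>: "\<psi> \<in> schwartz" and \<phi>: "\<phi> \<in> schwartz"
  shows "2 * of_real (c \<bullet> z) * wigner \<psi> \<phi> z
     = wigner (quant_form c \<psi>) \<phi> z + wigner \<psi> (quant_form (form_transpose c) \<phi>) z"
proof -
  obtain q \<xi> where z: "z = (q, \<xi>)" by fastforce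
  have "snd c \<bullet> \<xi> = (\<Sum>b\<in>Basis. (snd c \<bullet> b) * (b \<bullet> \<xi>))"
    by (subst euclidean_inner) (simp add: inner_commute)
  then have "2 * of_real (c \<bullet> z) * wigner \<psi> \<phi> z
     = 2 * of_real (fst c \<bullet> q) * wigner \<psi> \<phi> z
      + (\<Sum>b\<in>Basis. of_real (snd c \<bullet> b) * (2 * of_real (b \<bullet> \<xi>) * wigner \<psi> \<phi> z))"
    by (simp add: z inner_prod_def algebra_simps sum_distrib_left)
  also have "(\<Sum>b\<in>Basis. of_real (snd c \<bullet> b) * (2 * of_real (b \<bullet> \<xi>) * wigner \<psi> \<phi> z))
     = \<i> * (\<Sum>b\<in>Basis. of_real (snd c \<bullet> b) * wigner \<psi> (dir_deriv b \<phi>) z)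
      - \<i> * (\<Sum>b\<in>Basis. of_real (snd c \<bullet> b) * wigner (dir_deriv b \<psi>) \<phi> z)"
    unfolding z
    by (simp add: wigner_mult_momentum[OF \<psi> \<phi>] sum_distrib_left right_diff_distrib sum_subtractf
        mult.left_commute)
  finally show ?thesis
    unfolding z wigner_mult_position[OF \<psi> \<phi>] wigner_quant_form_expand(1)[OF \<psi> \<phi>] wigner_quant_form_expand(2)[OF \<phi> \<psi>]
    by (simp add: form_transpose_def sum_negf)
qed

section \<open>Fourier inversion\<close>

text \<open>
  The density of the standard normal distribution. As a product over coordinates it inherits its
  Fourier transform from the one-dimensional characteristic function.
\<close>

definition std_gauss :: "'v::euclidean_space \<Rightarrow> real" where
  "std_gauss x = (\<Prod>b\<in>Basis. std_normal_density (x \<bullet> b))"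

lemma integrable_std_gauss: "integrable lborel std_gauss"
  unfolding std_gauss_def[abs_def] by (rule integrable_lborel_prod) simp

lemma integral_std_gauss: "(\<integral>x. std_gauss x \<partial>lborel) = 1"
  unfolding std_gauss_def[abs_def] by (subst integral_lborel_prod) auto

lemma std_gauss_nonneg: "0 \<le> std_gauss x"
  unfolding std_gauss_def by (intro prod_nonneg) (simp add: normal_density_nonneg)

lemma std_gauss_eq: "std_gauss x = exp (- (norm x)\<^sup>2 / 2) / sqrt (2 * pi) ^ DIM('v)"
  for x :: "'v::euclidean_space"
proof -
  have "std_gauss x = (\<Prod>b\<in>Basis. (1 / sqrt (2 * pi)) * exp (- (x \<bullet> b)\<^sup>2 / 2))"
    by (simp add: std_gauss_def std_normal_density_def)
  also have "\<dots> = (1 / sqrt (2 * pi)) ^ DIM('v) * exp (\<Sum>b\<in>Basis. - (x \<bullet> b)\<^sup>2 / 2)"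
    by (simp only: prod.distrib prod_constant exp_sum finite_Basis)
  also have "(\<Sum>b\<in>Basis. - (x \<bullet> b)\<^sup>2 / 2) = - (norm x)\<^sup>2 / 2"
    by (subst norm_eq_sqrt_inner, subst euclidean_inner)
       (simp add: sum_nonneg sum_negf sum_divide_distrib power2_eq_square)
  finally show ?thesis by (simp add: power_divide)
qed

lemma std_gauss_continuous: "continuous_on A (\<lambda>x. std_gauss (f x))" if "continuous_on A f"
  unfolding std_gauss_eq by (intro continuous_intros that) auto

lemma std_gauss_measurable [measurable]: "std_gauss \<in> borel_measurable borel"
  by (intro borel_measurable_continuous_onI std_gauss_continuous continuous_intros)

lemma std_gauss_le: "std_gauss x \<le> std_gauss (0::'v)" for x :: "'v::euclidean_space"
  unfolding std_gauss_eq by (simp add: divide_right_mono)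

lemma fourier_std_gauss:
  "(\<integral>x. exp (\<i> * of_real (p \<bullet> x)) * of_real (std_gauss x) \<partial>lborel)
     = of_real (sqrt (2 * pi) ^ DIM('v) * std_gauss p)"
  for p :: "'v::euclidean_space"
proof -
  let ?f = "\<lambda>a t. exp (\<i> * of_real (a * t)) * complex_of_real (std_normal_density t)"
  have int: "integrable lborel (?f a)" for a
    by (rule Bochner_Integration.integrable_bound[OF integrable_normal_density[where \<mu> = 0 and \<sigma> = 1]]) (auto simp: norm_mult)
  have ch: "(\<integral>t. ?f a t \<partial>lborel) = of_real (exp (- (a\<^sup>2) / 2))" for a
  proof -
    have "char std_normal_distribution a = (\<integral>t. std_normal_density t *\<^sub>R exp (\<i> * of_real (a * t)) \<partial>lborel)"
      unfolding char_def by (subst integral_density) (auto simp: normal_density_nonneg)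
    then show ?thesis by (simp add: char_std_normal_distribution scaleR_conv_of_real mult.commute)
  qed
  have "exp (\<i> * of_real (p \<bullet> x)) * of_real (std_gauss x) = (\<Prod>b\<in>Basis. ?f (p \<bullet> b) (x \<bullet> b))" for x :: 'v
    by (subst euclidean_inner) (simp add: std_gauss_def prod.distrib exp_sum[symmetric] sum_distrib_left)
  then have "(\<integral>x. exp (\<i> * of_real (p \<bullet> x)) * of_real (std_gauss x) \<partial>lborel)
     = (\<Prod>b\<in>Basis. \<integral>t. ?f (p \<bullet> b) t \<partial>lborel)"
    using integral_lborel_prod[of "\<lambda>b::'v. ?f (p \<bullet> b)"] int by simp
  also have "\<dots> = of_real (\<Prod>b\<in>Basis. exp (- ((p \<bullet> b)\<^sup>2) / 2))"
    by (simp only: ch of_real_prod)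
  also have "(\<Prod>b\<in>Basis. exp (- ((p \<bullet> b)\<^sup>2) / 2)) = sqrt (2 * pi) ^ DIM('v) * std_gauss p"
    unfolding std_gauss_def std_normal_density_def by (simp add: prod.distrib power_divide prod_dividef)
  finally show ?thesis .
qed

lemma integral_scaleR_lborel:
  fixes f :: "'v::euclidean_space \<Rightarrow> complex"
  assumes [measurable]: "f \<in> borel_measurable borel" and r: "0 < r"
  shows "(\<integral>x. f x \<partial>lborel) = r ^ DIM('v) *\<^sub>R (\<integral>x. f (r *\<^sub>R x) \<partial>lborel)"
proof -
  have eq: "(lborel :: 'v measure) = density (distr lborel borel (\<lambda>x. r *\<^sub>R x)) (\<lambda>_. ennreal (r ^ DIM('v)))"
    using lborel_affine[of r "0::'v"] r by simp
  have "(\<integral>x. f x \<partial>lborel) = (\<integral>x. f x \<partial>(density (distr lborel borel (\<lambda>x. r *\<^sub>R x)) (\<lambda>_. ennreal (r ^ DIM('v)))))"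
    by (subst eq) (rule refl)
  also have "\<dots> = (\<integral>x. r ^ DIM('v) *\<^sub>R f x \<partial>(distr lborel borel (\<lambda>x. r *\<^sub>R x)))"
    using r by (subst integral_density) auto
  also have "\<dots> = (\<integral>x. r ^ DIM('v) *\<^sub>R f (r *\<^sub>R x) \<partial>lborel)"
    by (subst integral_distr) auto
  finally show ?thesis by simp
qed

lemma fourier_scaled_gauss:
  fixes p :: "'v::euclidean_space"
  assumes "0 < t"
  shows "(\<integral>x. exp (\<i> * of_real (p \<bullet> x)) * of_real (std_gauss (t *\<^sub>R x)) \<partial>lborel)
     = inverse t ^ DIM('v) *\<^sub>R of_real (sqrt (2 * pi) ^ DIM('v) * std_gauss (p /\<^sub>R t))"
proof -
  have "(\<integral>x. exp (\<i> * of_real (p \<bullet> x)) * of_real (std_gauss (t *\<^sub>R x)) \<partial>lborel)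
     = inverse t ^ DIM('v) *\<^sub>R (\<integral>x. exp (\<i> * of_real ((p /\<^sub>R t) \<bullet> x)) * of_real (std_gauss x) \<partial>lborel)"
    using assms by (subst integral_scaleR_lborel[of _ "inverse t"]) auto
  then show ?thesis by (simp only: fourier_std_gauss)
qed

text \<open>
  Inserting the Gaussian weight \<open>std_gauss (t *\<^sub>R \<xi>)\<close> makes the double integral absolutely convergent.
  Exchanging the order of integration moves the weight to the other side as a rescaled Gaussian, and
  both sides converge for \<open>t\<close> tending to zero by dominated convergence.
\<close>

lemma fourier_inversion_at_0:
  fixes g :: "'v::euclidean_space \<Rightarrow> complex"
  assumes g: "integrable lborel g" and cont: "continuous_on UNIV g" and bdd: "\<And>x. norm (g x) \<le> B"
    and fg: "integrable lborel (\<lambda>\<xi>. \<integral>p. exp (\<i> * of_real (p \<bullet> \<xi>)) * g p \<partial>lborel)"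
  shows "(\<integral>\<xi>. (\<integral>p. exp (\<i> * of_real (p \<bullet> \<xi>)) * g p \<partial>lborel) \<partial>lborel) = of_real ((2 * pi) ^ DIM('v)) * g 0"
proof -
  let ?F = "\<lambda>\<xi>. \<integral>p. exp (\<i> * of_real (p \<bullet> \<xi>)) * g p \<partial>lborel"
  let ?G = "std_gauss :: 'v \<Rightarrow> real"
  let ?s = "sqrt (2 * pi) ^ DIM('v)"
  define t where "t n = inverse (real (Suc n))" for n
  have t: "0 < t n" for n by (simp add: t_def)
  have "t \<longlonglongrightarrow> 0" unfolding t_def by (rule LIMSEQ_inverse_real_of_nat)
  then have t0: "(\<lambda>n. t n *\<^sub>R x) \<longlonglongrightarrow> 0 *\<^sub>R x" for x :: 'v by (intro tendsto_scaleR tendsto_const)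
  have [measurable]: "g \<in> borel_measurable borel" using cont by (rule borel_measurable_continuous_onI)
  have [measurable]: "?F \<in> borel_measurable borel" using borel_measurable_integrable[OF fg] by simp
  have exchange: "(\<integral>\<xi>. of_real (?G (t n *\<^sub>R \<xi>)) * ?F \<xi> \<partial>lborel)
      = of_real ?s * (\<integral>p. of_real (?G p) * g (t n *\<^sub>R p) \<partial>lborel)" for n
  proof -
    let ?h = "\<lambda>\<xi> p. of_real (?G (t n *\<^sub>R \<xi>)) * (exp (\<i> * of_real (p \<bullet> \<xi>)) * g p)"
    have Gt: "integrable lborel (\<lambda>\<xi>. ?G (t n *\<^sub>R \<xi>))"
      unfolding std_gauss_def inner_scaleR_left
      using lborel_integrable_real_affine[OF integrable_normal_density[where \<mu> = 0 and \<sigma> = 1], of "t n" 0] t[of n]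
      by (intro integrable_lborel_prod[of "\<lambda>_ x. std_normal_density (t n * x)"]) simp
    have int: "integrable (lborel \<Otimes>\<^sub>M lborel) (case_prod ?h)"
    proof (rule lborel_pair.Fubini_integrable)
      have "(\<lambda>\<xi>. \<integral>p. norm (case_prod ?h (\<xi>, p)) \<partial>lborel) = (\<lambda>\<xi>. ?G (t n *\<^sub>R \<xi>) * (\<integral>p. norm (g p) \<partial>lborel))"
        by (simp add: norm_mult std_gauss_nonneg)
      then show "integrable lborel (\<lambda>\<xi>. \<integral>p. norm (case_prod ?h (\<xi>, p)) \<partial>lborel)"
        using Gt by simp
      have "integrable lborel (\<lambda>p. exp (\<i> * of_real (p \<bullet> \<xi>)) * g p)" for \<xi>
        by (rule Bochner_Integration.integrable_bound[OF g]) (auto simp: norm_mult)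
      then show "AE \<xi> in lborel. integrable lborel (\<lambda>p. case_prod ?h (\<xi>, p))"
        by simp
    qed measurable
    have inner: "(\<integral>\<xi>. ?h \<xi> p \<partial>lborel)
        = g p * (\<integral>\<xi>. exp (\<i> * of_real (p \<bullet> \<xi>)) * of_real (?G (t n *\<^sub>R \<xi>)) \<partial>lborel)" for p
    proof -
      have "(\<integral>\<xi>. ?h \<xi> p \<partial>lborel)
          = (\<integral>\<xi>. g p * (exp (\<i> * of_real (p \<bullet> \<xi>)) * of_real (?G (t n *\<^sub>R \<xi>))) \<partial>lborel)"
        by (rule Bochner_Integration.integral_cong) (simp_all add: mult_ac)
      then show ?thesis by simp
    qed
    have "(\<integral>\<xi>. of_real (?G (t n *\<^sub>R \<xi>)) * ?F \<xi> \<partial>lborel) = (\<integral>\<xi>. (\<integral>p. ?h \<xi> p \<partial>lborel) \<partial>lborel)" by simp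
    also have "\<dots> = (\<integral>p. (\<integral>\<xi>. ?h \<xi> p \<partial>lborel) \<partial>lborel)"
      by (rule lborel_pair.Fubini_integral[OF int, symmetric])
    also have "\<dots> = (\<integral>p. g p * (\<integral>\<xi>. exp (\<i> * of_real (p \<bullet> \<xi>)) * of_real (?G (t n *\<^sub>R \<xi>)) \<partial>lborel) \<partial>lborel)"
      by (simp only: inner)
    also have "\<dots> = (\<integral>p. g p * (inverse (t n) ^ DIM('v) *\<^sub>R of_real (?s * ?G (p /\<^sub>R t n))) \<partial>lborel)"
      by (simp only: fourier_scaled_gauss[OF t])
    \<comment> \<open>Substituting \<open>t n *\<^sub>R p\<close> for \<open>p\<close> moves the concentration of the Gaussian into the argument of \<open>g\<close>.\<close>
    also have "\<dots> = t n ^ DIM('v) *\<^sub>R (\<integral>p. g (t n *\<^sub>R p) * (inverse (t n) ^ DIM('v) *\<^sub>R of_real (?s * ?G p)) \<partial>lborel)"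
      using t[of n] by (subst integral_scaleR_lborel[of _ "t n"]) auto
    also have "\<dots> = (\<integral>p. of_real ?s * (of_real (?G p) * g (t n *\<^sub>R p)) \<partial>lborel)"
    proof -
      have "t n ^ DIM('v) *\<^sub>R (g (t n *\<^sub>R p) * (inverse (t n) ^ DIM('v) *\<^sub>R of_real (?s * ?G p)))
          = of_real ?s * (of_real (?G p) * g (t n *\<^sub>R p))" for p
      proof -
        have "complex_of_real (t n ^ DIM('v)) * of_real (inverse (t n) ^ DIM('v)) = 1"
          using t[of n] by (simp add: of_real_mult[symmetric] power_mult_distrib[symmetric] del: of_real_mult of_real_power)
        then show ?thesis unfolding scaleR_conv_of_real of_real_mult by algebra
      qed
      then show ?thesis by (simp only: integral_scaleR_right[symmetric])
    qed
    finally show ?thesis by simp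
  qed
  have B: "0 \<le> B" using order_trans[OF norm_ge_zero bdd[of 0]] .
  have lim1: "(\<lambda>n. \<integral>\<xi>. of_real (?G (t n *\<^sub>R \<xi>)) * ?F \<xi> \<partial>lborel) \<longlonglongrightarrow> (\<integral>\<xi>. of_real (?G 0) * ?F \<xi> \<partial>lborel)"
  proof (rule integral_dominated_convergence)
    show "integrable lborel (\<lambda>\<xi>. ?G 0 * norm (?F \<xi>))" using fg by simp
    have "(\<lambda>n. ?G (t n *\<^sub>R \<xi>)) \<longlonglongrightarrow> ?G (0 *\<^sub>R \<xi>)" for \<xi>
      using std_gauss_continuous[OF continuous_on_id, of UNIV]
      by (rule continuous_on_tendsto_compose) (use t0 in auto)
    then show "AE \<xi> in lborel. (\<lambda>n. of_real (?G (t n *\<^sub>R \<xi>)) * ?F \<xi>) \<longlonglongrightarrow> of_real (?G 0) * ?F \<xi>"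
      by (intro AE_I2 tendsto_mult tendsto_of_real tendsto_const) simp
    show "AE \<xi> in lborel. norm (of_real (?G (t n *\<^sub>R \<xi>)) * ?F \<xi>) \<le> ?G 0 * norm (?F \<xi>)" for n
      unfolding norm_mult
      by (intro AE_I2 mult_right_mono) (auto simp: std_gauss_nonneg std_gauss_le)
  qed measurable
  have lim2: "(\<lambda>n. \<integral>p. of_real (?G p) * g (t n *\<^sub>R p) \<partial>lborel) \<longlonglongrightarrow> (\<integral>p. of_real (?G p) * g 0 \<partial>lborel)"
  proof (rule integral_dominated_convergence)
    show "integrable lborel (\<lambda>p. ?G p * B)" by (intro integrable_mult_left integrable_std_gauss)
    have "(\<lambda>n. g (t n *\<^sub>R p)) \<longlonglongrightarrow> g (0 *\<^sub>R p)" for p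
      using cont by (rule continuous_on_tendsto_compose) (use t0 in auto)
    then show "AE p in lborel. (\<lambda>n. of_real (?G p) * g (t n *\<^sub>R p)) \<longlonglongrightarrow> of_real (?G p) * g 0"
      by (intro AE_I2 tendsto_mult tendsto_const) simp
    show "AE p in lborel. norm (of_real (?G p) * g (t n *\<^sub>R p)) \<le> ?G p * B" for n
      unfolding norm_mult
      by (intro AE_I2 mult_mono) (auto simp: std_gauss_nonneg bdd B)
  qed measurable
  have "(\<integral>p. complex_of_real (?G p) * g 0 \<partial>lborel) = g 0"
    using integrable_std_gauss[where 'a = 'v] integral_std_gauss[where 'a = 'v] by simp
  then have "(\<lambda>n. \<integral>\<xi>. of_real (?G (t n *\<^sub>R \<xi>)) * ?F \<xi> \<partial>lborel) \<longlonglongrightarrow> of_real ?s * g 0"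
    using tendsto_mult[OF tendsto_const[of "complex_of_real ?s"] lim2] by (simp only: exchange)
  from LIMSEQ_unique[OF this lim1] have main: "of_real ?s * g 0 = of_real (?G 0) * (\<integral>\<xi>. ?F \<xi> \<partial>lborel)"
    by simp
  have G0: "?G 0 = inverse ?s" by (simp add: std_gauss_eq inverse_eq_divide)
  have solve: "I = of_real (S * S) * w" if eq: "of_real S * w = of_real (inverse S) * I" and "S \<noteq> 0"
    for S :: real and w I :: complex
  proof -
    have "of_real (S * S) * w = of_real S * (of_real S * w)" by simp
    also have "\<dots> = of_real S * (of_real (inverse S) * I)" by (simp only: eq)
    also have "\<dots> = I" using \<open>S \<noteq> 0\<close> by simp
    finally show ?thesis ..
  qed
  have ss: "?s * ?s = (2 * pi) ^ DIM('v)"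
    by (simp only: power_mult_distrib[symmetric]) simp
  have "?s \<noteq> 0" by simp
  from solve[OF main[unfolded G0] this] show ?thesis unfolding ss .
qed

section \<open>Decay and integrals of Wigner functions\<close>

lemma wigner_mult_linear_square:
  assumes \<psi>: "\<psi> \<in> schwartz" and \<phi>: "\<phi> \<in> schwartz"
  shows "of_real ((c \<bullet> z)\<^sup>2) * wigner \<psi> \<phi> z = (1/4) * (wigner (quant_form c (quant_form c \<psi>)) \<phi> z
     + 2 * wigner (quant_form c \<psi>) (quant_form (form_transpose c) \<phi>) z
     + wigner \<psi> (quant_form (form_transpose c) (quant_form (form_transpose c) \<phi>)) z)"
proof -
  let ?P = "quant_form c" and ?Q = "quant_form (form_transpose c)"
  have "4 * (of_real ((c \<bullet> z)\<^sup>2) * wigner \<psi> \<phi> z)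
      = 2 * of_real (c \<bullet> z) * (2 * of_real (c \<bullet> z) * wigner \<psi> \<phi> z)"
    by (simp add: power2_eq_square)
  also have "\<dots> = 2 * of_real (c \<bullet> z) * wigner (?P \<psi>) \<phi> z + 2 * of_real (c \<bullet> z) * wigner \<psi> (?Q \<phi>) z"
    unfolding wigner_mult_linear[OF \<psi> \<phi>] by (simp add: distrib_left)
  also have "\<dots> = wigner (?P (?P \<psi>)) \<phi> z + 2 * wigner (?P \<psi>) (?Q \<phi>) z + wigner \<psi> (?Q (?Q \<phi>)) z"
    by (simp add: wigner_mult_linear \<psi> \<phi> schwartz_quant_form)
  finally have "(1/4) * (4 * (of_real ((c \<bullet> z)\<^sup>2) * wigner \<psi> \<phi> z)) = (1/4) * (wigner (?P (?P \<psi>)) \<phi> z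
     + 2 * wigner (?P \<psi>) (?Q \<phi>) z + wigner \<psi> (?Q (?Q \<phi>)) z)" by (rule arg_cong)
  then show ?thesis by simp
qed

text \<open>
  By \<open>wigner_mult_linear_square\<close>, a quadratic weight times a Wigner function is a combination of Wigner
  functions of other Schwartz functions, and those are bounded. Induction over the factors yields
  decay in all phase space variables simultaneously. Taking all basis vectors gives integrability
  on phase space; taking the momentum directions only gives integrability on each fibre.
\<close>

lemma wigner_prod_bounded:
  fixes \<psi> \<phi> :: "'v::euclidean_space \<Rightarrow> complex"
  assumes "finite S" "\<psi> \<in> schwartz" "\<phi> \<in> schwartz"
  shows "\<exists>C. \<forall>z. (\<Prod>c\<in>S. 1 + (c \<bullet> z)\<^sup>2) * norm (wigner \<psi> \<phi> z) \<le> C"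
  using assms
proof (induction S arbitrary: \<psi> \<phi> rule: finite_induct)
  case empty
  then show ?case using wigner_bounded by simp
next
  case (insert c S)
  let ?P = "quant_form c" and ?Q = "quant_form (form_transpose c)"
  let ?p = "\<lambda>z. \<Prod>c\<in>S. 1 + (c \<bullet> z)\<^sup>2"
  note \<psi> = insert.prems(1) and \<phi> = insert.prems(2)
  obtain A1 A2 A3 A4 where
    A1: "\<And>z. ?p z * norm (wigner \<psi> \<phi> z) \<le> A1" and
    A2: "\<And>z. ?p z * norm (wigner (?P (?P \<psi>)) \<phi> z) \<le> A2" and
    A3: "\<And>z. ?p z * norm (wigner (?P \<psi>) (?Q \<phi>) z) \<le> A3" and
    A4: "\<And>z. ?p z * norm (wigner \<psi> (?Q (?Q \<phi>)) z) \<le> A4"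
    using insert.IH[OF \<psi> \<phi>] insert.IH[OF schwartz_quant_form[OF schwartz_quant_form[OF \<psi>]] \<phi>]
      insert.IH[OF schwartz_quant_form[OF \<psi>] schwartz_quant_form[OF \<phi>]]
      insert.IH[OF \<psi> schwartz_quant_form[OF schwartz_quant_form[OF \<phi>]]] by metis
  have "(\<Prod>c\<in>insert c S. 1 + (c \<bullet> z)\<^sup>2) * norm (wigner \<psi> \<phi> z) \<le> A1 + (1/4) * (A2 + 2 * A3 + A4)" for z
  proof -
    have p: "0 \<le> ?p z" by (intro prod_nonneg) auto
    have "(c \<bullet> z)\<^sup>2 * norm (wigner \<psi> \<phi> z) = norm (of_real ((c \<bullet> z)\<^sup>2) * wigner \<psi> \<phi> z)"
      by (simp only: norm_mult norm_of_real abs_power2)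
    also have "\<dots> \<le> (1/4) * (norm (wigner (?P (?P \<psi>)) \<phi> z)
         + 2 * norm (wigner (?P \<psi>) (?Q \<phi>) z) + norm (wigner \<psi> (?Q (?Q \<phi>)) z))"
      unfolding wigner_mult_linear_square[OF \<psi> \<phi>] norm_mult
      by (intro mult_mono order_trans[OF norm_triangle_ineq] add_mono)
         (auto simp: norm_mult intro!: order_trans[OF norm_triangle_ineq])
    finally have "?p z * ((c \<bullet> z)\<^sup>2 * norm (wigner \<psi> \<phi> z)) \<le> ?p z * ((1/4) * (norm (wigner (?P (?P \<psi>)) \<phi> z)
         + 2 * norm (wigner (?P \<psi>) (?Q \<phi>) z) + norm (wigner \<psi> (?Q (?Q \<phi>)) z)))"
      by (rule mult_left_mono[OF _ p])
    also have "\<dots> \<le> (1/4) * (A2 + 2 * A3 + A4)"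
      using A2[of z] A3[of z] A4[of z] by (simp add: algebra_simps)
    finally show ?thesis
      using A1[of z] insert.hyps by (simp add: algebra_simps)
  qed
  then show ?case by blast
qed

lemma le_mult_prod_inverseI:
  fixes g :: "'c \<Rightarrow> real"
  assumes "(\<Prod>c\<in>S. 1 + (g c)\<^sup>2) * r \<le> C"
  shows "r \<le> C * (\<Prod>c\<in>S. inverse (1 + (g c)\<^sup>2))"
proof -
  define p where "p = (\<Prod>c\<in>S. 1 + (g c)\<^sup>2)"
  have "0 < p" unfolding p_def by (intro prod_pos) (auto simp: add_pos_nonneg)
  moreover have "(\<Prod>c\<in>S. inverse (1 + (g c)\<^sup>2)) = inverse p"
    using prod_inversef[of "\<lambda>c. 1 + (g c)\<^sup>2" S] by (simp only: o_def p_def)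
  moreover have "p * r \<le> C" using assms by (simp only: p_def)
  ultimately show ?thesis by (simp only:) (simp add: field_simps)
qed

lemma wigner_integrable:
  fixes \<psi> \<phi> :: "'v::euclidean_space \<Rightarrow> complex"
  assumes "\<psi> \<in> schwartz" "\<phi> \<in> schwartz"
  shows "integrable lborel (wigner \<psi> \<phi>)"
    and "integrable lborel (\<lambda>\<xi>. wigner \<psi> \<phi> (q, \<xi>))"
proof -
  note [measurable] = wigner_measurable[OF assms]
  obtain C where "\<And>z. (\<Prod>c\<in>Basis. 1 + (c \<bullet> z)\<^sup>2) * norm (wigner \<psi> \<phi> z) \<le> C"
    using wigner_prod_bounded[OF finite_Basis assms] by blast
  then have "norm (wigner \<psi> \<phi> z) \<le> C * (\<Prod>c\<in>Basis. inverse (1 + (c \<bullet> z)\<^sup>2))" for z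
    by (rule le_mult_prod_inverseI)
  then show "integrable lborel (wigner \<psi> \<phi>)"
    by (intro Bochner_Integration.integrable_bound[OF integrable_mult_right[OF integrable_lborel_prod_inverse_square, of C]])
       (auto intro!: AE_I2 intro: order_trans[OF _ abs_ge_self] simp: inner_commute)
  have "(\<lambda>\<xi>. (q, \<xi>)) \<in> borel_measurable borel"
    by (intro borel_measurable_continuous_onI continuous_intros)
  then have m: "(\<lambda>\<xi>. wigner \<psi> \<phi> (q, \<xi>)) \<in> borel_measurable borel" by measurable
  obtain C where C: "\<And>z. (\<Prod>c\<in>Pair 0 ` Basis. 1 + (c \<bullet> z)\<^sup>2) * norm (wigner \<psi> \<phi> z) \<le> C"
    using wigner_prod_bounded[OF finite_imageI[OF finite_Basis] assms] by blast
  have "(\<Prod>b\<in>Basis. 1 + (b \<bullet> \<xi>)\<^sup>2) * norm (wigner \<psi> \<phi> (q, \<xi>)) \<le> C" for \<xi>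
    using C[of "(q, \<xi>)"] by (subst (asm) prod.reindex) (auto simp: inj_on_def)
  then have "norm (wigner \<psi> \<phi> (q, \<xi>)) \<le> C * (\<Prod>b\<in>Basis. inverse (1 + (b \<bullet> \<xi>)\<^sup>2))" for \<xi>
    by (rule le_mult_prod_inverseI)
  then show "integrable lborel (\<lambda>\<xi>. wigner \<psi> \<phi> (q, \<xi>))"
    using m
    by (intro Bochner_Integration.integrable_bound[OF integrable_mult_right[OF integrable_lborel_prod_inverse_square, of C]])
       (auto intro!: AE_I2 intro: order_trans[OF _ abs_ge_self] simp: inner_commute)
qed

text \<open>
  For fixed \<open>q\<close>, the Wigner function is the Fourier transform in \<open>p\<close> of the kernel
  \<open>\<psi> (q - p/2) * \<phi> (q + p/2)\<close>, whose value at \<open>p = 0\<close> is \<open>\<psi> q * \<phi> q\<close>. In terms of operators: the Weyl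
  symbol of the identity is 1.
\<close>

lemma integral_wigner:
  fixes \<psi> \<phi> :: "'v::euclidean_space \<Rightarrow> complex"
  assumes \<psi>: "\<psi> \<in> schwartz" and \<phi>: "\<phi> \<in> schwartz"
  shows "(\<integral>z. wigner \<psi> \<phi> z \<partial>lborel) = of_real ((2 * pi) ^ DIM('v)) * (\<integral>x. \<psi> x * \<phi> x \<partial>lborel)"
proof -
  have int: "integrable (lborel \<Otimes>\<^sub>M lborel) (wigner \<psi> \<phi>)"
    using wigner_integrable(1)[OF assms] by (simp only: lborel_prod)
  from wigner_kernel_decay[OF assms, of 0] obtain B where
    "\<And>q p. norm (wigner_kernel \<psi> \<phi> q p) \<le> B * inverse ((1 + norm p) ^ 0)" by blast
  then have B: "norm (wigner_kernel \<psi> \<phi> q p) \<le> B" for q p by simp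
  have slice: "(\<integral>\<xi>. wigner \<psi> \<phi> (q, \<xi>) \<partial>lborel) = of_real ((2 * pi) ^ DIM('v)) * (\<psi> q * \<phi> q)" for q
  proof -
    have "continuous_on UNIV (\<lambda>p. wigner_kernel \<psi> \<phi> q p)"
      by (intro continuous_intros continuous_on_compose2[OF schwartz_continuous[OF \<psi>]]
       continuous_on_compose2[OF schwartz_continuous[OF \<phi>]]) auto
    from fourier_inversion_at_0[OF _ this B] show ?thesis
      using wigner_integrable(2)[OF assms, of q] wigner_integrand_integrable[OF assms, of 0 q]
      by (simp add: wigner_eq)
  qed
  have "(\<integral>z. wigner \<psi> \<phi> z \<partial>lborel) = (\<integral>q. (\<integral>\<xi>. wigner \<psi> \<phi> (q, \<xi>) \<partial>lborel) \<partial>lborel)"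
    unfolding lborel_pair.integral_fst'[OF int] by (simp only: lborel_prod)
  then show ?thesis by (simp add: slice)
qed

text \<open>
  After integration, each of the three terms of \<open>wigner_mult_linear_square\<close> gives the same pairing,
  because transposition moves all operators onto \<open>\<psi>\<close>; their weights 1, 2, 1 add up to 4.
\<close>

lemma
  fixes \<psi> \<phi> :: "'v::euclidean_space \<Rightarrow> complex"
  assumes \<psi>: "\<psi> \<in> schwartz" and \<phi>: "\<phi> \<in> schwartz"
  shows integrable_square_wigner: "integrable lborel (\<lambda>z. of_real ((c \<bullet> z)\<^sup>2) * wigner \<psi> \<phi> z)"
    and integral_square_wigner: "(\<integral>z. of_real ((c \<bullet> z)\<^sup>2) * wigner \<psi> \<phi> z \<partial>lborel)
      = of_real ((2 * pi) ^ DIM('v)) * (\<integral>x. quant_form c (quant_form c \<psi>) x * \<phi> x \<partial>lborel)"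
proof -
  let ?P = "quant_form c" and ?Q = "quant_form (form_transpose c)"
  note P = schwartz_quant_form[OF \<psi>, of c] and Q = schwartz_quant_form[OF \<phi>, of "form_transpose c"]
  note PP = schwartz_quant_form[OF P, of c] and QQ = schwartz_quant_form[OF Q, of "form_transpose c"]
  note int = wigner_integrable(1)[OF PP \<phi>] wigner_integrable(1)[OF P Q] wigner_integrable(1)[OF \<psi> QQ]
  show "integrable lborel (\<lambda>z. of_real ((c \<bullet> z)\<^sup>2) * wigner \<psi> \<phi> z)"
    unfolding wigner_mult_linear_square[OF \<psi> \<phi>] using int by auto
  have "(\<integral>z. of_real ((c \<bullet> z)\<^sup>2) * wigner \<psi> \<phi> z \<partial>lborel)
     = (1/4) * ((\<integral>z. wigner (?P (?P \<psi>)) \<phi> z \<partial>lborel)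
       + 2 * (\<integral>z. wigner (?P \<psi>) (?Q \<phi>) z \<partial>lborel) + (\<integral>z. wigner \<psi> (?Q (?Q \<phi>)) z \<partial>lborel))"
    unfolding wigner_mult_linear_square[OF \<psi> \<phi>] using int by simp
  also have "\<dots> = of_real ((2 * pi) ^ DIM('v)) * (\<integral>x. ?P (?P \<psi>) x * \<phi> x \<partial>lborel)"
    by (simp add: integral_wigner PP QQ P Q \<psi> \<phi> integral_quant_form_transpose[symmetric])
  finally show "(\<integral>z. of_real ((c \<bullet> z)\<^sup>2) * wigner \<psi> \<phi> z \<partial>lborel)
      = of_real ((2 * pi) ^ DIM('v)) * (\<integral>x. ?P (?P \<psi>) x * \<phi> x \<partial>lborel)" .
qed

section \<open>Tempered distributions given by functions\<close>

lemma schwartz_norm_bound: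
  assumes "f \<in> schwartz"
  shows "(1 + norm x) ^ N * norm (f x) \<le> schwartz_norm N f"
proof -
  let ?h = "\<lambda>ds x. (1 + norm x) ^ N * norm (partials ds f x)"
  let ?D = "{ds. set ds \<subseteq> Basis \<and> length ds \<le> N}"
  have bdd: "bdd_above (range (?h ds))" if "ds \<in> ?D" for ds
    using assms that unfolding schwartz_def by auto
  have "?h [] x \<le> (SUP x. ?h [] x)" by (rule cSUP_upper) (auto intro: bdd[of "[]", simplified])
  also have "\<dots> \<le> (\<Sum>ds\<in>?D. SUP x. ?h ds x)"
  proof (rule member_le_sum)
    show "finite ?D" by (rule finite_lists_length_le) simp
    show "0 \<le> (SUP x. ?h ds x)" if "ds \<in> ?D - {[]}" for ds
      by (rule cSUP_upper2[OF bdd, of _ 0]) (use that in auto)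
  qed auto
  finally show ?thesis by (simp add: schwartz_norm_def)
qed

lemma tempered_distr_of:
  fixes h :: "'a::euclidean_space \<Rightarrow> complex"
  assumes [measurable]: "h \<in> borel_measurable borel" and h: "\<And>x. norm (h x) \<le> C * (1 + norm x) ^ N"
  shows "tempered (distr_of h)"
proof -
  let ?K = "2 * DIM('a)"
  let ?w = "\<lambda>x::'a. inverse ((1 + norm x) ^ ?K)"
  have C: "0 \<le> C" using order_trans[OF norm_ge_zero h[of 0]] by simp
  have bound: "norm (h x * f x) \<le> (C * schwartz_norm (N + ?K) f) * ?w x" if f: "f \<in> schwartz" for f x
  proof -
    have p: "0 < (1 + norm x) ^ ?K" by (simp add: add_pos_nonneg)
    have "norm (h x * f x) \<le> (C * (1 + norm x) ^ N) * norm (f x)"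
      unfolding norm_mult by (intro mult_right_mono h) auto
    also have "\<dots> = C * ((1 + norm x) ^ (N + ?K) * norm (f x)) * ?w x"
    proof -
      have "C * ((1 + norm x) ^ (N + ?K) * norm (f x)) * ?w x
          = (C * (1 + norm x) ^ N) * norm (f x) * ((1 + norm x) ^ ?K * ?w x)"
        by (simp only: power_add mult_ac)
      then show ?thesis using right_inverse[OF less_imp_neq[OF p, THEN not_sym]] by (simp only: mult_1_right)
    qed
    also have "\<dots> \<le> C * schwartz_norm (N + ?K) f * ?w x"
      using p by (intro mult_right_mono mult_left_mono schwartz_norm_bound f C) auto
    finally show ?thesis .
  qed
  have int: "integrable lborel (\<lambda>x. h x * f x)" if f: "f \<in> schwartz" for f
    using schwartz_borel_measurable[OF f] bound[OF f] by (intro integrable_if_decay) auto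
  have "norm (distr_of h f) \<le> (C * (\<integral>x. ?w x \<partial>lborel)) * schwartz_norm (N + ?K) f" if f: "f \<in> schwartz" for f
  proof -
    have "norm (distr_of h f) \<le> (\<integral>x. (C * schwartz_norm (N + ?K) f) * ?w x \<partial>lborel)"
      unfolding distr_of_def
      by (intro Bochner_Integration.integral_norm_bound_integral int f integrable_mult_right integrable_inverse_power_norm bound)
    then show ?thesis using integrable_inverse_power_norm by (simp add: mult_ac)
  qed
  moreover have "distr_of h (\<lambda>x. f x + g x) = distr_of h f + distr_of h g"
    if "f \<in> schwartz" "g \<in> schwartz" for f g
    using int[OF that(1)] int[OF that(2)] by (simp add: distr_of_def distrib_left)
  moreover have "distr_of h (\<lambda>x. c * f x) = c * distr_of h f" for c f
    by (simp add: distr_of_def mult.left_commute)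
  ultimately show ?thesis unfolding tempered_def by blast
qed

lemma tempered_cong:
  assumes "tempered v" "\<And>f. f \<in> schwartz \<Longrightarrow> u f = v f"
  shows "tempered u"
  using assms(1) unfolding tempered_def by (simp add: assms(2) schwartz_add schwartz_cmult)

lemma tempered_distr_of_schwartz: "f \<in> schwartz \<Longrightarrow> tempered (distr_of f)"
proof -
  assume f: "f \<in> schwartz"
  from schwartz_decay[OF f, of 0] obtain C where "\<And>x. norm (f x) \<le> C" by auto
  then show ?thesis by (intro tempered_distr_of[of _ C 0] schwartz_borel_measurable f) simp
qed

section \<open>Operators whose Weyl symbol is a sum of two squares\<close>

text \<open>
  Both the symbol in two variables and its extension to four variables have this form.
\<close>

definition two_squares :: "'a::real_inner \<Rightarrow> 'a \<Rightarrow> 'a \<Rightarrow> complex" where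
  "two_squares u v z = of_real ((u \<bullet> z)\<^sup>2 + (v \<bullet> z)\<^sup>2)"

lemma tempered_distr_of_two_squares:
  fixes u v :: "'a::euclidean_space"
  shows "tempered (distr_of (two_squares u v))"
proof (rule tempered_distr_of)
  show "two_squares u v \<in> borel_measurable borel"
    unfolding two_squares_def[abs_def] by (intro borel_measurable_continuous_onI continuous_intros)
  fix z
  have sq: "(w \<bullet> z)\<^sup>2 \<le> (norm w)\<^sup>2 * (1 + norm z)\<^sup>2" for w :: 'a
  proof -
    have "\<bar>w \<bullet> z\<bar> \<le> norm w * (1 + norm z)"
      by (rule order_trans[OF Cauchy_Schwarz_ineq2]) (simp add: mult_left_mono)
    then have "\<bar>w \<bullet> z\<bar>\<^sup>2 \<le> (norm w * (1 + norm z))\<^sup>2" by (rule power_mono) simp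
    then show ?thesis by (simp add: power_mult_distrib)
  qed
  show "norm (two_squares u v z) \<le> ((norm u)\<^sup>2 + (norm v)\<^sup>2) * (1 + norm z) ^ 2"
    using add_mono[OF sq[of u] sq[of v]] unfolding two_squares_def norm_of_real by (simp add: distrib_right)
qed

text \<open>
  Continuity in \<open>\<psi>\<close> is reduced to that of integration against a fixed Schwartz function, by
  transposing the operator onto \<open>\<phi>\<close>.
\<close>

lemma has_weyl_symbol_two_squares:
  fixes H :: "('v::euclidean_space \<Rightarrow> complex) \<Rightarrow> 'v \<Rightarrow> complex"
  assumes H: "\<And>\<psi>. \<psi> \<in> schwartz \<Longrightarrow> H \<psi> = (\<lambda>x. quant_form c (quant_form c \<psi>) x + quant_form d (quant_form d \<psi>) x)"
  shows "has_weyl_symbol (oper_of H) (distr_of (two_squares c d))"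
proof -
  let ?T = "\<lambda>c \<phi>. quant_form (form_transpose c) (quant_form (form_transpose c) \<phi>)"
  let ?Ht = "\<lambda>\<phi> x. ?T c \<phi> x + ?T d \<phi> x"
  have HS: "H \<psi> \<in> schwartz" if "\<psi> \<in> schwartz" for \<psi>
    unfolding H[OF that] by (intro schwartz_add schwartz_quant_form that)
  have pair: "oper_of H \<psi> \<phi> = (\<integral>x. quant_form c (quant_form c \<psi>) x * \<phi> x \<partial>lborel)
      + (\<integral>x. quant_form d (quant_form d \<psi>) x * \<phi> x \<partial>lborel)"
    if "\<psi> \<in> schwartz" "\<phi> \<in> schwartz" for \<psi> \<phi>
    unfolding oper_of_def distr_of_def H[OF that(1)] distrib_right
    by (intro Bochner_Integration.integral_add schwartz_mult_integrable schwartz_quant_form that)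
  have transpose: "oper_of H \<psi> \<phi> = distr_of (?Ht \<phi>) \<psi>" if "\<psi> \<in> schwartz" "\<phi> \<in> schwartz" for \<psi> \<phi>
  proof -
    have "distr_of (?Ht \<phi>) \<psi> = (\<integral>x. \<psi> x * ?T c \<phi> x \<partial>lborel) + (\<integral>x. \<psi> x * ?T d \<phi> x \<partial>lborel)"
      unfolding distr_of_def distrib_right mult.commute[of _ "\<psi> _"]
      by (intro Bochner_Integration.integral_add schwartz_mult_integrable schwartz_quant_form that)
    then show ?thesis
      unfolding pair[OF that] by (simp add: integral_quant_form_transpose schwartz_quant_form that)
  qed
  have "tempered (\<lambda>\<psi>. oper_of H \<psi> \<phi>)" if \<phi>: "\<phi> \<in> schwartz" for \<phi>
    by (rule tempered_cong[OF tempered_distr_of_schwartz transpose[OF _ \<phi>]])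
       (intro schwartz_add schwartz_quant_form \<phi>)
  then have cont: "continuous_oper (oper_of H)"
    unfolding continuous_oper_def by (auto simp: oper_of_def intro: tempered_distr_of_schwartz HS)
  have "oper_of H \<psi> \<phi> = weyl_op (distr_of (two_squares c d)) \<psi> \<phi>"
    if "\<psi> \<in> schwartz" "\<phi> \<in> schwartz" for \<psi> \<phi>
  proof -
    have "distr_of (two_squares c d) (wigner \<psi> \<phi>) = of_real ((2 * pi) ^ DIM('v)) * oper_of H \<psi> \<phi>"
      using integrable_square_wigner[OF that]
      unfolding pair[OF that] distr_of_def two_squares_def of_real_add distrib_right
      by (simp only: Bochner_Integration.integral_add integral_square_wigner[OF that] distrib_left)
    then show ?thesis unfolding weyl_op_def by simp
  qed
  then show ?thesis
    unfolding has_weyl_symbol_def using cont tempered_distr_of_two_squares by blast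
qed

section \<open>The Shubin class of a sum of two squares\<close>

definition lin_form :: "'a::real_inner \<Rightarrow> 'a \<Rightarrow> complex" where
  "lin_form l z = of_real (l \<bullet> z)"

lemma has_dir_deriv_inner:
  "((\<lambda>t. l \<bullet> (z + t *\<^sub>R d)) has_real_derivative l \<bullet> d) (at 0)"
  by (auto intro!: derivative_eq_intros simp: inner_add_right)

lemma has_dir_deriv_two_squares:
  "((\<lambda>t. two_squares u v (z + t *\<^sub>R d)) has_vector_derivative
      lin_form (2 *\<^sub>R ((u \<bullet> d) *\<^sub>R u + (v \<bullet> d) *\<^sub>R v)) z) (at 0)"
  unfolding two_squares_def lin_form_def
  by (intro has_vector_derivative_of_real)
     (auto intro!: derivative_eq_intros has_dir_deriv_inner
       simp: inner_add_left has_real_derivative_iff_has_vector_derivative[symmetric])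

lemma has_dir_deriv_lin_form:
  "((\<lambda>t. lin_form l (z + t *\<^sub>R d)) has_vector_derivative lin_form l d) (at 0)"
  unfolding lin_form_def
  by (intro has_vector_derivative_of_real)
     (use has_dir_deriv_inner in \<open>simp add: has_real_derivative_iff_has_vector_derivative\<close>)

text \<open>
  A homogeneous quadratic polynomial has linear first, constant second and vanishing higher
  derivatives. The orders are recorded because the Shubin estimates depend on them.
\<close>

lemma partials_two_squares_cases:
  obtains (zero) "ds = []" "partials ds (two_squares u v) = two_squares u v"
  | (one) l where "length ds = 1" "partials ds (two_squares u v) = lin_form l"
  | (two) c where "length ds = 2" "partials ds (two_squares u v) = (\<lambda>z. c)"
  | (more) "partials ds (two_squares u v) = (\<lambda>z. 0)"
proof -
  have "ds = [] \<or> (length ds = 1 \<and> (\<exists>l. partials ds (two_squares u v) = lin_form l))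
      \<or> (length ds = 2 \<and> (\<exists>c. partials ds (two_squares u v) = (\<lambda>z. c)))
      \<or> partials ds (two_squares u v) = (\<lambda>z. 0)"
  proof (induction ds)
    case (Cons d ds)
    have q: "dir_deriv d (two_squares u v) = lin_form (2 *\<^sub>R ((u \<bullet> d) *\<^sub>R u + (v \<bullet> d) *\<^sub>R v))"
      by (rule ext) (rule dir_deriv_eqI[OF has_dir_deriv_two_squares])
    have l: "dir_deriv d (lin_form l) = (\<lambda>z. lin_form l d)" for l
      by (rule ext) (rule dir_deriv_eqI[OF has_dir_deriv_lin_form])
    have c: "dir_deriv d (\<lambda>z. c) = (\<lambda>z. 0)" for c
      by (rule ext) (rule dir_deriv_eqI, simp)
    from Cons.IH show ?case by (auto simp: q l c)
  qed simp
  then show thesis using that by auto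
qed

lemma smooth_along_two_squares: "smooth_along B (two_squares u v)"
proof -
  have "continuous_on (span B) (partials ds (two_squares u v)) \<and>
     (\<lambda>t. partials ds (two_squares u v) (x + t *\<^sub>R b)) differentiable at 0" for ds x b
  proof (cases ds u v rule: partials_two_squares_cases)
    case zero
    then show ?thesis
      using differentiableI_vector[OF has_dir_deriv_two_squares]
      by (auto simp: two_squares_def[abs_def] intro!: continuous_intros)
  next
    case (one l)
    then show ?thesis
      using differentiableI_vector[OF has_dir_deriv_lin_form]
      by (auto simp: lin_form_def[abs_def] intro!: continuous_intros)
  qed auto
  then show ?thesis unfolding smooth_along_def by blast
qed

text \<open>
  On \<open>span B\<close> the symbol is \<open>\<bar>z\<bar>\<^sup>2\<close>, and a derivative of order \<open>j\<close> is bounded by a multiple of \<open>\<bar>z\<bar>\<close> to the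
  power \<open>2 - j\<close>.
\<close>

lemma two_squares_in_shubin_class:
  assumes norm: "\<And>z. z \<in> span B \<Longrightarrow> (u \<bullet> z)\<^sup>2 + (v \<bullet> z)\<^sup>2 = (norm z)\<^sup>2"
  shows "two_squares u v \<in> shubin_class B 2 2 1"
proof -
  let ?a = "two_squares u v"
  have a: "norm (?a z) = (norm z)\<^sup>2" if "z \<in> span B" for z
    using norm[OF that] unfolding two_squares_def norm_of_real by simp
  have bounds: "1 * norm z powr 2 \<le> norm (?a z) \<and> norm (?a z) \<le> 1 * norm z powr 2"
    if "z \<in> span B" "1 \<le> norm z" for z
    using that by (simp add: a)
  have deriv: "\<exists>C\<ge>0. \<forall>z\<in>span B. 1 \<le> norm z \<longrightarrow>
      norm (partials ds ?a z) \<le> C * norm (?a z) * norm z powr (- 1 * real (length ds))" for ds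
  proof (cases ds u v rule: partials_two_squares_cases)
    case zero
    then show ?thesis by (intro exI[of _ 1]) auto
  next
    case (one l)
    have "norm (lin_form l z) \<le> norm l * norm (?a z) * norm z powr (- 1)"
      if "z \<in> span B" "1 \<le> norm z" for z
    proof -
      have z: "norm z \<noteq> 0" using that(2) by linarith
      have "norm z powr (- 1) = inverse (norm z)" using that(2) by (simp add: powr_minus)
      then have "norm l * norm (?a z) * norm z powr (- 1) = norm l * norm z"
        using z by (simp add: a[OF that(1)] power2_eq_square)
      then show ?thesis unfolding lin_form_def norm_of_real by (simp add: Cauchy_Schwarz_ineq2)
    qed
    then show ?thesis using one by (intro exI[of _ "norm l"]) auto
  next
    case (two c)
    have "norm c \<le> norm c * norm (?a z) * norm z powr (- 2)" if "z \<in> span B" "1 \<le> norm z" for z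
    proof -
      have "norm z \<noteq> 0" using that(2) by linarith
      moreover have "norm z powr (- 2) = inverse ((norm z)\<^sup>2)" using that(2) by (simp add: powr_minus)
      ultimately have "norm (?a z) * norm z powr (- 2) = 1" by (simp add: a[OF that(1)])
      then show ?thesis by (simp only: mult.assoc mult_1_right)
    qed
    then show ?thesis using two by (intro exI[of _ "norm c"]) auto
  next
    case more
    then show ?thesis by (intro exI[of _ 0]) auto
  qed
  show ?thesis
    unfolding shubin_class_def mem_Collect_eq
  proof (intro conjI exI[of _ "1::real"])
    show "smooth_along B ?a" by (rule smooth_along_two_squares)
    show "\<forall>z\<in>span B. 1 \<le> norm z \<longrightarrow> 1 * norm z powr 2 \<le> norm (?a z) \<and> norm (?a z) \<le> 1 * norm z powr 2"
      using bounds by blast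
    show "\<forall>ds. set ds \<subseteq> B \<longrightarrow> (\<exists>C\<ge>0. \<forall>z\<in>span B. 1 \<le> norm z \<longrightarrow>
        norm (partials ds ?a z) \<le> C * norm (?a z) * norm z powr (- 1 * real (length ds)))"
      using deriv by blast
  qed auto
qed

section \<open>The Landau Hamiltonian\<close>

lemma quant_form_coordinate_momentum:
  assumes "d \<in> Basis"
  shows "quant_form (l, d) \<psi> = (\<lambda>x. of_real (l \<bullet> x) * \<psi> x - \<i> * dir_deriv d \<psi> x)"
proof -
  have "(\<Sum>b\<in>Basis. of_real (d \<bullet> b) * dir_deriv b \<psi> x) = dir_deriv d \<psi> x" for x
  proof -
    have "(\<Sum>b\<in>Basis. of_real (d \<bullet> b) * dir_deriv b \<psi> x)
        = (\<Sum>b\<in>Basis. if b = d then dir_deriv b \<psi> x else 0)"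
      using assms by (intro sum.cong) (auto simp: inner_Basis)
    then show ?thesis using assms by simp
  qed
  then show ?thesis by (simp add: quant_form_def)
qed

text \<open>
  Orthogonality of \<open>l\<close> and \<open>d\<close> makes multiplication by \<open>l \<bullet> x\<close> commute with the derivative along \<open>d\<close>.
\<close>

lemma quant_form_square:
  assumes \<psi>: "\<psi> \<in> schwartz" and d: "d \<in> Basis" and "l \<bullet> d = 0"
  shows "quant_form (l, d) (quant_form (l, d) \<psi>) x = of_real ((l \<bullet> x)\<^sup>2) * \<psi> x
    - 2 * \<i> * of_real (l \<bullet> x) * dir_deriv d \<psi> x - dir_deriv d (dir_deriv d \<psi>) x"
proof -
  let ?L = "\<lambda>x. complex_of_real (l \<bullet> x)"
  have "((\<lambda>t. ?L (x + t *\<^sub>R d) * \<psi> (x + t *\<^sub>R d) - \<i> * dir_deriv d \<psi> (x + t *\<^sub>R d)) has_vector_derivative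
      (?L x * dir_deriv d \<psi> x + ?L d * \<psi> x) - \<i> * dir_deriv d (dir_deriv d \<psi>) x) (at 0)"
    by (intro has_vector_derivative_diff has_vector_derivative_mult_right has_dir_deriv_inner_mult
         schwartz_has_dir_deriv schwartz_dir_deriv \<psi> d)
  from dir_deriv_eqI[OF this]
  have eq: "dir_deriv d (\<lambda>x. ?L x * \<psi> x - \<i> * dir_deriv d \<psi> x) x
      = ?L x * dir_deriv d \<psi> x - \<i> * dir_deriv d (dir_deriv d \<psi>) x"
    using assms(3) by simp
  show ?thesis
    unfolding quant_form_coordinate_momentum[OF d] eq
    by (simp add: algebra_simps power2_eq_square)
qed

text \<open>
  The linear forms \<open>\<xi> + y/2\<close> and \<open>\<eta> - x/2\<close> at \<open>((x, y), (\<xi>, \<eta>))\<close>, the components of the kinetic momentum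
  in the symmetric gauge.
\<close>

abbreviation landau_form1 :: "(real \<times> real) \<times> (real \<times> real)" where
  "landau_form1 \<equiv> ((0, 1/2), (1, 0))"

abbreviation landau_form2 :: "(real \<times> real) \<times> (real \<times> real)" where
  "landau_form2 \<equiv> ((- 1/2, 0), (0, 1))"

lemma landau_hamiltonian_eq:
  assumes "\<psi> \<in> schwartz"
  shows "landau_hamiltonian \<psi> = (\<lambda>x. quant_form landau_form1 (quant_form landau_form1 \<psi>) x
      + quant_form landau_form2 (quant_form landau_form2 \<psi>) x)"
proof -
  have B: "(1, 0) \<in> (Basis :: (real \<times> real) set)" "(0, 1) \<in> (Basis :: (real \<times> real) set)"
    by (simp_all add: Basis_prod_def)
  have o: "((0::real), (1/2::real)) \<bullet> (1, 0) = 0" "((-1/2::real), (0::real)) \<bullet> (0, 1) = 0" by simp_all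
  show ?thesis
    unfolding quant_form_square[OF assms B(1) o(1)] quant_form_square[OF assms B(2) o(2)]
    by (auto simp: fun_eq_iff landau_hamiltonian_def algebra_simps power2_eq_square add_divide_distrib)
qed

text \<open>
  With the sign that makes the bracket of \<open>\<xi>\<close> and \<open>x\<close> equal to 1, the Poisson bracket of
  \<open>\<eta> - x/2\<close> and \<open>\<xi> + y/2\<close> is 1, so they serve as a momentum and its conjugate
  position. The forms \<open>\<eta> + x/2\<close> and \<open>\<xi> - y/2\<close>, the conserved coordinates of the guiding centre up to
  sign and order, Poisson commute with both and complete them to a symplectic coordinate system.
\<close>

definition landau_symplectic :: "(real \<times> real) \<times> (real \<times> real) \<Rightarrow> (real \<times> real) \<times> (real \<times> real)" where
  "landau_symplectic = (\<lambda>((x, y), (\<xi>, \<eta>)). ((\<xi> + y/2, \<eta> + x/2), (\<eta> - x/2, \<xi> - y/2)))"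

lemma landau_symplectic_Sp: "landau_symplectic \<in> Sp"
proof -
  let ?s = landau_symplectic
  let ?r = "\<lambda>((X, Y), (\<Xi>, H)). ((Y - \<Xi>, X - H), ((X + H)/2, (Y + \<Xi>)/2)) :: (real \<times> real) \<times> (real \<times> real)"
  have "linear ?s"
    by (rule linearI) (auto simp: landau_symplectic_def algebra_simps add_divide_distrib)
  moreover have "bij ?s"
    by (rule o_bij[of ?r]) (auto simp: landau_symplectic_def fun_eq_iff field_simps)
  moreover have "sympl_form (?s z) (?s z') = sympl_form z z'" for z z'
    by (cases z; cases z') (auto simp: landau_symplectic_def sympl_form_def field_simps)
  ultimately show ?thesis unfolding Sp_def by blast
qed

theorem proposition24:
  shows "oper_of landau_hamiltonian \<in> ext_shubin_class 2 2 1"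
proof -
  let ?J = "{(1, 0)} :: (real \<times> real) set"
  let ?u = "((1, 0), 0) :: (real \<times> real) \<times> (real \<times> real)"
  let ?v = "(0, (1, 0)) :: (real \<times> real) \<times> (real \<times> real)"
  let ?a = "two_squares ?u ?v"
  have J: "?J \<subseteq> Basis" "card ?J = DIM(real \<times> real) - 1" by (auto simp: Basis_prod_def)
  have "phase_basis ?J = {?u, ?v}" by (auto simp: phase_basis_def zero_prod_def)
  moreover have "(?u \<bullet> z)\<^sup>2 + (?v \<bullet> z)\<^sup>2 = (norm z)\<^sup>2" if "z \<in> span {?u, ?v}" for z
  proof -
    from that obtain r where "z - r *\<^sub>R ?u \<in> span {?v}" by (auto simp only: span_breakdown_eq)
    then obtain s where "z - r *\<^sub>R ?u = s *\<^sub>R ?v" by (auto simp only: span_singleton)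
    then have "z = r *\<^sub>R ?u + s *\<^sub>R ?v" by (simp only: diff_eq_eq add.commute)
    then show ?thesis by (simp only: power2_norm_eq_inner) (simp add: zero_prod_def power2_eq_square)
  qed
  ultimately have a: "?a \<in> shubin_class (phase_basis ?J) 2 2 1"
    by (intro two_squares_in_shubin_class) auto
  have ext: "sympl_ext ?J landau_symplectic ?a = two_squares landau_form1 landau_form2"
    by (auto simp: fun_eq_iff sympl_ext_def tensor_one_def coord_proj_def landau_symplectic_def
        two_squares_def zero_prod_def algebra_simps)
  show ?thesis
    unfolding ext_shubin_class_def mem_Collect_eq
  proof (intro exI conjI bexI)
    show "1 < DIM(real \<times> real)" by simp
    show "smooth (sympl_ext ?J landau_symplectic ?a)"
      unfolding ext by (rule smooth_along_two_squares)
    show "has_weyl_symbol (oper_of landau_hamiltonian) (distr_of (sympl_ext ?J landau_symplectic ?a))"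
      unfolding ext by (intro has_weyl_symbol_two_squares landau_hamiltonian_eq)
  qed (use J a landau_symplectic_Sp in auto)
qed

end
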